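(* Let $D\subseteq\mathbb{C}$ be a domain, let $\mathcal{F}$ be a family of holomorphic functions on $D$, and let $a$ and $b\neq 0$ be two distinct complex numbers. Let $A\subset\mathbb{C}$ be a compact set with $b\notin A$, and let $B=\{z\in\mathbb{C}:|z-a|\geq\epsilon\}$ for some $\epsilon>0$. Suppose that for each $f\in\mathcal{F}$, $f$ and $f'$ partially share the pair $(a,A)$, and $f'$ and $f$ partially share the pair $(b,B)$; that is, for every $z\in D$: $f(z)=a$ implies $f'(z)\in A$, and $f'(z)=b$ implies $f(z)\in B$. Then $\mathcal{F}$ is normal in $D$.
   Context: For a set $S\subset\mathbb{C}$ and $\alpha\in\mathbb{C}$, two meromorphic functions $f,g$ on $D$ partially share the pair $(\alpha,S)$ if for every $z\in D$, $f(z)=\alpha$ implies $g(z)\in S$. A family $\mathcal{F}$ of meromorphic (in particular, holomorphic) functions on $D$ is normal in $D$ if every sequence in $\mathcal{F}$ has a subsequence converging locally uniformly in $D$ with respect to the spherical metric; the limit is a meromorphic function on $D$ or identically $\infty$. *)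

theory Defs
  imports "HOL-Complex_Analysis.Complex_Analysis"
begin

datatype riemann_sphere = Finite complex | Infinity

text \<open>
  The chordal distance is the Euclidean distance in \<open>\<real>\<^sup>3\<close> between the stereographic projections
  to the unit sphere; the spherical distance is the length of the shortest arc between them, which
  is \<open>2 arcsin (c / 2)\<close> for a chord of length \<open>c \<le> 2\<close>.
\<close>

fun chordal_dist :: "riemann_sphere \<Rightarrow> riemann_sphere \<Rightarrow> real" where
  "chordal_dist (Finite z) (Finite w) =
     2 * cmod (z - w) / (sqrt (1 + (cmod z)\<^sup>2) * sqrt (1 + (cmod w)\<^sup>2))"
| "chordal_dist (Finite z) Infinity = 2 / sqrt (1 + (cmod z)\<^sup>2)"
| "chordal_dist Infinity (Finite w) = 2 / sqrt (1 + (cmod w)\<^sup>2)"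
| "chordal_dist Infinity Infinity = 0"

definition spherical_dist :: "riemann_sphere \<Rightarrow> riemann_sphere \<Rightarrow> real" where
  "spherical_dist p q = 2 * arcsin (chordal_dist p q / 2)"

text \<open>
  A meromorphic function is represented, as in the library, by a function \<open>complex \<Rightarrow> complex\<close>,
  whose value at a pole carries no meaning; \<open>sphere_val\<close> gives its value on the sphere.
\<close>

definition sphere_val :: "(complex \<Rightarrow> complex) \<Rightarrow> complex \<Rightarrow> riemann_sphere" where
  "sphere_val f z = (if is_pole f z then Infinity else Finite (f z))"

lemma sphere_val_holomorphic:
  assumes "open D" "f holomorphic_on D" "z \<in> D"
  shows "sphere_val f z = Finite (f z)"
  using not_is_pole_holomorphic[OF assms(1,3,2)] by (simp add: sphere_val_def)

definition partially_share ::
  "complex set \<Rightarrow> (complex \<Rightarrow> complex) \<Rightarrow> (complex \<Rightarrow> complex) \<Rightarrow> complex \<Rightarrow> complex set \<Rightarrow> bool" where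
  "partially_share D f g \<alpha> S \<longleftrightarrow>
     (\<forall>z\<in>D. sphere_val f z = Finite \<alpha> \<longrightarrow> sphere_val g z \<in> Finite ` S)"

lemma partially_share_holomorphic_iff:
  assumes "open D" "f holomorphic_on D" "g holomorphic_on D"
  shows "partially_share D f g \<alpha> S \<longleftrightarrow> (\<forall>z\<in>D. f z = \<alpha> \<longrightarrow> g z \<in> S)"
  using assms by (auto simp: partially_share_def sphere_val_holomorphic)

definition spherically_converges_locally_uniformly_on ::
  "(nat \<Rightarrow> complex \<Rightarrow> riemann_sphere) \<Rightarrow> (complex \<Rightarrow> riemann_sphere) \<Rightarrow> complex set \<Rightarrow> bool" where
  "spherically_converges_locally_uniformly_on f g D \<longleftrightarrow>
     (\<forall>z\<in>D. \<exists>U. open U \<and> z \<in> U \<and> U \<subseteq> D \<and>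
        (\<forall>e>0. \<forall>\<^sub>F n in sequentially. \<forall>w\<in>U. spherical_dist (f n w) (g w) < e))"

text \<open>
  \<open>nicely_meromorphic_on\<close> excludes wrong values of the limit at removable singularities.
\<close>

definition normal_family_on :: "(complex \<Rightarrow> complex) set \<Rightarrow> complex set \<Rightarrow> bool" where
  "normal_family_on \<F> D \<longleftrightarrow>
     (\<forall>f. (\<forall>n::nat. f n \<in> \<F>) \<longrightarrow>
        (\<exists>r g. strict_mono (r :: nat \<Rightarrow> nat) \<and>
           ((\<exists>h. h nicely_meromorphic_on D \<and> (\<forall>z\<in>D. g z = sphere_val h z)) \<or>
            (\<forall>z\<in>D. g z = Infinity)) \<and>
           spherically_converges_locally_uniformly_on (\<lambda>n. sphere_val (f (r n))) g D))"

end

theory Submission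
  imports Defs
begin

text \<open>
  After subtracting \<open>a\<close> the hypotheses say, for \<open>g = f - a\<close>: at zeros of \<open>g\<close> the derivative is bounded by
  a constant \<open>M\<close>, and wherever \<open>g' = b\<close>, the value of \<open>g\<close> has modulus at least \<open>\<epsilon>\<close>. By Marty's criterion,
  normality follows once the spherical derivatives \<open>|g'| / (1 + |g|\<^sup>2)\<close> are locally bounded.

  Suppose they are not. Because of the bound at zeros, a rescaling of Zalcman-Pang type can scale values
  and arguments by the same factor: there are centres \<open>c\<close>, scales \<open>\<rho>\<close> tending to \<open>0\<close> and members \<open>g\<close> of
  the family such that the functions \<open>G \<zeta> = g (c + \<rho> \<zeta>) / \<rho>\<close> live on growing discs, have bounded
  spherical derivatives, and satisfy \<open>|G' 0| \<ge> M + 1\<close> (\<open>rescaling_centre\<close>). Derivatives do not change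
  under this scaling. So \<open>|G'| \<le> M\<close> at zeros of \<open>G\<close>, while \<open>G' = b\<close> forces \<open>|G| \<ge> \<epsilon> / \<rho>\<close>,
  which tends to infinity. A limit of such functions is an entire function \<open>h\<close> with bounded spherical
  derivative and with \<open>|h' 0| > M\<close>; the limit infinity is ruled out by the normalisation at \<open>0\<close>. By
  Hurwitz' theorem \<open>|h'| \<le> M\<close> at zeros of \<open>h\<close>, and \<open>h'\<close> either omits \<open>b\<close> or is constantly \<open>b\<close>.

  No such \<open>h\<close> exists (\<open>no_extremal_entire_function\<close>). An affine \<open>h\<close> has a zero at which the derivative is
  \<open>h' 0\<close>, too large. Otherwise \<open>h' = b + exp H\<close>. An entire function with bounded spherical derivative
  has exponential type (\<open>entire_exponential_growth\<close>), so \<open>H\<close> is affine and \<open>h\<close> is a linear function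
  plus an exponential. It has infinitely many zeros, and \<open>h'\<close> is unbounded on them.
\<close>

section \<open>Holomorphic functions with positive real part\<close>

text \<open>
  The Cayley transform \<open>u \<mapsto> (u - f z0) / (u + cnj (f z0))\<close> maps the right half-plane to the unit
  disc and \<open>f z0\<close> to \<open>0\<close>, so this is the Schwarz lemma for the transformed function. It has two
  consequences: Harnack's inequality, used on discs where an entire function is large, and a bound
  of Borel-Caratheodory type, used to show that an exponent is affine.
\<close>

lemma Schwarz_right_half_plane:
  assumes hol: "f holomorphic_on ball z0 R"
    and pos: "\<And>z. z \<in> ball z0 R \<Longrightarrow> Re (f z) > 0"
    and w: "w \<in> ball z0 R"
  shows "R * cmod (f w - f z0) \<le> cmod (w - z0) * cmod (f w + cnj (f z0))"
proof -
  have R: "R > 0"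
    using w by (metis ball_eq_empty empty_iff not_le)
  have pos0: "Re (f z0) > 0"
    using pos R by simp
  have ne: "u + cnj (f z0) \<noteq> 0" if "Re u > 0" for u
    using that pos0 by (auto simp: complex_eq_iff)
  have in_disc: "cmod ((u - f z0) / (u + cnj (f z0))) < 1" if "Re u > 0" for u
  proof -
    have "(cmod (u + cnj (f z0)))\<^sup>2 - (cmod (u - f z0))\<^sup>2 = 4 * Re u * Re (f z0)"
      by (simp only: cmod_power2) (simp add: power2_eq_square algebra_simps)
    then have "(cmod (u - f z0))\<^sup>2 < (cmod (u + cnj (f z0)))\<^sup>2"
      using that pos0 by (smt (verit) mult_pos_pos)
    then have "cmod (u - f z0) < cmod (u + cnj (f z0))"
      by (rule power_less_imp_less_base) simp
    then show ?thesis
      using ne[OF that] by (simp add: norm_divide divide_simps)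
  qed
  have map: "z0 + of_real R * \<zeta> \<in> ball z0 R" if "cmod \<zeta> < 1" for \<zeta>
    using that R by (simp add: dist_norm norm_mult)
  define \<Phi> where "\<Phi> \<zeta> = (f (z0 + of_real R * \<zeta>) - f z0) / (f (z0 + of_real R * \<zeta>) + cnj (f z0))" for \<zeta>
  have inner: "(\<lambda>\<zeta>. f (z0 + of_real R * \<zeta>)) holomorphic_on ball 0 1"
    using map by (intro holomorphic_on_compose_gen[OF _ hol, unfolded o_def]
        holomorphic_intros) auto
  have "\<Phi> holomorphic_on ball 0 1"
    unfolding \<Phi>_def using pos[OF map] ne by (intro holomorphic_intros inner) auto
  moreover have "\<Phi> 0 = 0"
    by (simp add: \<Phi>_def)
  moreover have "cmod (\<Phi> \<zeta>) < 1" if "cmod \<zeta> < 1" for \<zeta>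
    unfolding \<Phi>_def by (rule in_disc[OF pos[OF map[OF that]]])
  moreover have "cmod ((w - z0) / of_real R) < 1"
    using w R by (simp add: dist_norm norm_divide norm_minus_commute)
  ultimately have "cmod (\<Phi> ((w - z0) / of_real R)) \<le> cmod ((w - z0) / of_real R)"
    by (rule Schwarz_Lemma(1))
  then have "cmod (f w - f z0) / cmod (f w + cnj (f z0)) \<le> cmod (w - z0) / R"
    using R by (simp add: \<Phi>_def norm_divide)
  then show ?thesis
    using R ne[OF pos[OF w]] by (simp add: field_simps)
qed

text \<open>
  Both norms in the Schwarz estimate are of numbers with the same imaginary part
  \<open>Im (f w) - Im (f z0)\<close>. It carries the larger factor on the left, so it can be dropped there and
  on the right.
\<close>

lemma Harnack_lower_bound:
  assumes hol: "f holomorphic_on ball z0 R"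
    and pos: "\<And>z. z \<in> ball z0 R \<Longrightarrow> Re (f z) > 0"
    and w: "w \<in> ball z0 R"
  shows "(R - cmod (w - z0)) * Re (f z0) \<le> (R + cmod (w - z0)) * Re (f w)"
proof -
  define d where "d = cmod (w - z0)"
  let ?x = "Re (f w)" and ?c = "Re (f z0)" and ?y = "Im (f w) - Im (f z0)"
  have d: "0 \<le> d" "d < R"
    using w by (auto simp: d_def dist_norm norm_minus_commute)
  then have R: "0 < R"
    by linarith
  have xpos: "?x > 0" "?c > 0"
    using pos[OF w] pos[of z0] R by auto
  have "(R * cmod (f w - f z0))\<^sup>2 \<le> (d * cmod (f w + cnj (f z0)))\<^sup>2"
    using Schwarz_right_half_plane[OF assms] R unfolding d_def by (intro power_mono) auto
  then have "R\<^sup>2 * ((?x - ?c)\<^sup>2 + ?y\<^sup>2) \<le> d\<^sup>2 * ((?x + ?c)\<^sup>2 + ?y\<^sup>2)"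
    unfolding power_mult_distrib by (simp only: cmod_power2) simp
  moreover have "d\<^sup>2 * ?y\<^sup>2 \<le> R\<^sup>2 * ?y\<^sup>2"
    using d by (intro mult_right_mono power_mono) auto
  ultimately have "(R * (?c - ?x))\<^sup>2 \<le> (d * (?x + ?c))\<^sup>2"
    unfolding power_mult_distrib power2_commute[of ?c ?x] by (simp add: distrib_left)
  then have "R * (?c - ?x) \<le> d * (?x + ?c)"
    by (rule power2_le_imp_le) (use d xpos in auto)
  then show ?thesis
    by (simp add: algebra_simps d_def)
qed

lemma norm_bound_of_positive_Re:
  assumes hol: "f holomorphic_on ball z0 R"
    and pos: "\<And>z. z \<in> ball z0 R \<Longrightarrow> Re (f z) > 0"
    and w: "w \<in> ball z0 R"
  shows "(R - cmod (w - z0)) * cmod (f w) \<le> (R + cmod (w - z0)) * cmod (f z0)"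
proof -
  let ?d = "cmod (w - z0)"
  have d: "0 \<le> ?d" "?d < R"
    using w by (auto simp: dist_norm norm_minus_commute)
  then have R: "0 < R"
    by linarith
  have "R * (cmod (f w) - cmod (f z0)) \<le> R * cmod (f w - f z0)"
    using R norm_triangle_ineq2[of "f w" "f z0"] by (intro mult_left_mono) auto
  also have "\<dots> \<le> ?d * cmod (f w + cnj (f z0))"
    by (rule Schwarz_right_half_plane[OF assms])
  also have "\<dots> \<le> ?d * (cmod (f w) + cmod (f z0))"
    using norm_triangle_ineq[of "f w" "cnj (f z0)"] by (intro mult_left_mono) auto
  finally show ?thesis
    by (simp add: algebra_simps)
qed

text \<open>
  On the disc of radius \<open>2 |z|\<close> the function \<open>m - H\<close> has positive real part for some \<open>m\<close> linear in
  \<open>|z|\<close>. So \<open>|H z|\<close> grows at most linearly, and Liouville's theorem for polynomials applies.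
\<close>

lemma entire_linear_Re_bound_imp_affine:
  assumes hol: "H holomorphic_on UNIV"
    and le: "\<And>z. Re (H z) \<le> C * (1 + cmod z)"
  obtains \<alpha> \<beta> where "\<And>z. H z = \<alpha> * z + \<beta>"
proof -
  let ?B = "12 * \<bar>C\<bar> + 4 + 3 * cmod (H 0)"
  have "cmod (H z) \<le> ?B * cmod z ^ 1" if z: "1 \<le> cmod z" for z
  proof -
    define m where "m = \<bar>C\<bar> * (1 + 2 * cmod z) + 1"
    have m0: "m \<ge> 0"
      by (simp add: m_def)
    have "Re (of_real m - H u) > 0" if "u \<in> ball 0 (2 * cmod z)" for u
    proof -
      have "Re (H u) \<le> C * (1 + cmod u)"
        by (rule le)
      also have "\<dots> \<le> \<bar>C\<bar> * (1 + cmod u)"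
        by (rule mult_right_mono) auto
      also have "\<dots> \<le> \<bar>C\<bar> * (1 + 2 * cmod z)"
        using that by (intro mult_left_mono) auto
      finally show ?thesis
        by (simp add: m_def)
    qed
    moreover have "(\<lambda>u. of_real m - H u) holomorphic_on ball 0 (2 * cmod z)"
      by (intro holomorphic_intros holomorphic_on_subset[OF hol]) auto
    ultimately have "(2 * cmod z - cmod (z - 0)) * cmod (of_real m - H z)
        \<le> (2 * cmod z + cmod (z - 0)) * cmod (of_real m - H 0)"
      using z by (intro norm_bound_of_positive_Re) auto
    then have "cmod z * cmod (of_real m - H z) \<le> cmod z * (3 * cmod (of_real m - H 0))"
      by (simp add: algebra_simps)
    then have "cmod (of_real m - H z) \<le> 3 * cmod (of_real m - H 0)"
      using z by (subst (asm) mult_le_cancel_left_pos) auto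
    moreover have "cmod (of_real m - H 0) \<le> m + cmod (H 0)"
      using norm_triangle_ineq4[of "of_real m" "H 0"] m0 by simp
    moreover have "cmod (H z) \<le> m + cmod (of_real m - H z)"
      using norm_triangle_ineq4[of "of_real m" "of_real m - H z"] m0 by simp
    ultimately have "cmod (H z) \<le> 4 * m + 3 * cmod (H 0)"
      by linarith
    also have "\<dots> \<le> ?B * cmod z"
    proof -
      have "\<bar>C\<bar> \<le> \<bar>C\<bar> * cmod z" "cmod (H 0) \<le> cmod (H 0) * cmod z"
        using z by (auto simp: mult_le_cancel_left1)
      then show ?thesis
        using z unfolding m_def by (simp add: algebra_simps)
    qed
    finally show ?thesis
      by simp
  qed
  then have series: "H z = (\<Sum>k\<le>1. (deriv ^^ k) H 0 / fact k * z ^ k)" for z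
    by (rule Liouville_polynomial[OF hol])
  have "H z = deriv H 0 * z + H 0" for z
    by (subst series) simp
  then show ?thesis
    by (rule that)
qed

text \<open>
  Solutions of \<open>exp v = s v\<close> are fixed points of \<open>v \<mapsto> Ln v + Ln s + 2 \<pi> i k\<close>. For each \<open>k \<ge> 1\<close> this
  map is a contraction of a half-plane that avoids the branch cut, and the imaginary part of its
  fixed point grows with \<open>k\<close>.
\<close>

lemma exp_eq_linear_unbounded_solutions:
  assumes s: "s \<noteq> (0::complex)"
  obtains v where "exp v = s * v" and "R < cmod v"
proof -
  define k where "k = nat \<lceil>\<bar>R\<bar>\<rceil> + 1"
  have k: "1 \<le> k" "\<bar>R\<bar> \<le> real k"
    unfolding k_def by linarith+
  define T where "T v = Ln v + Ln s + of_real (2 * pi * real k) * \<i>" for v :: complex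
  \<comment> \<open>On this half-plane the derivative \<open>1 / v\<close> of \<open>T\<close> has modulus at most \<open>1/2\<close>.\<close>
  define S where "S = {v::complex. 2 \<le> Im v}"
  have Im_T: "Im (T v) > 2 * pi * real k - pi" if "v \<in> S" for v
    using that Im_Ln_pos_lt_imp[of v] mpi_less_Im_Ln[OF s] by (simp add: T_def S_def)
  have big: "2 * pi * real k - pi \<ge> 2 + real k - 1" 
  proof -
    have "3 * (real k - 1) \<le> pi * (real k - 1)"
      using k pi_gt3 by (intro mult_right_mono) auto
    then have "pi * real k \<ge> 3 * real k - 3 + pi"
      by (simp add: algebra_simps)
    then show ?thesis
      using k pi_gt3 by linarith
  qed
  have "\<exists>!v\<in>S. T v = v"
  proof (rule Banach_fix)
    show "complete S"
      unfolding S_def by (simp add: complete_eq_closed closed_halfspace_Im_ge)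
    show "S \<noteq> {}"
      by (auto simp: S_def intro!: exI[of _ "2 * \<i>"])
    show "T ` S \<subseteq> S"
      using Im_T big k unfolding S_def by fastforce
    have convex: "convex S"
      unfolding S_def by (rule convex_halfspace_Im_ge)
    have der: "(T has_field_derivative inverse v) (at v within S)" if "v \<in> S" for v
    proof -
      have "v \<notin> \<real>\<^sub>\<le>\<^sub>0"
        using that by (auto simp: S_def complex_nonpos_Reals_iff)
      then show ?thesis
        unfolding T_def by (auto intro!: derivative_eq_intros)
    qed
    have bound: "cmod (inverse v) \<le> 1/2" if "v \<in> S" for v
    proof -
      have "2 \<le> cmod v"
        using that abs_Im_le_cmod[of v] by (simp add: S_def)
      then show ?thesis
        by (auto simp: norm_inverse intro: le_imp_inverse_le[of 2, simplified])
    qed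
    show "dist (T x) (T y) \<le> 1/2 * dist x y" if "x \<in> S" "y \<in> S" for x y
      using field_differentiable_bound[OF convex der bound, of x y] that
      by (simp add: dist_norm)
  qed auto
  then obtain v where v: "v \<in> S" "T v = v"
    by blast
  have "v \<noteq> 0"
    using v by (auto simp: S_def)
  have "exp v = exp (T v)"
    using v by simp
  also have "\<dots> = v * s * exp (2 * of_real (real k) * of_real pi * \<i>)"
    unfolding T_def using \<open>v \<noteq> 0\<close> s by (simp add: exp_add mult_ac)
  also have "exp (2 * of_real (real k) * of_real pi * \<i>) = 1"
    using exp_integer_2pi[of "of_nat k"] by (simp add: Ints_of_nat)
  finally have "exp v = s * v"
    by simp
  moreover have "R < cmod v"
    using Im_T[OF v(1)] v(2) big k abs_Im_le_cmod[of v] by simp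
  ultimately show ?thesis
    by (rule that)
qed

section \<open>Entire functions with bounded spherical derivative\<close>

text \<open>
  A bound for the derivative on the level set \<open>|f| = 1\<close> forces exponential type; this is the
  Clunie-Hayman theorem for entire functions, by an argument in the style of Pommerenke. Let
  \<open>|f z| > 1\<close> and take the largest disc about \<open>z\<close>, of radius \<open>R\<close>, on which \<open>|f| > 1\<close>. There
  \<open>ln |f|\<close> is a positive harmonic function that vanishes at a boundary point \<open>w\<close>. By Harnack's
  inequality it decays along the radius towards \<open>w\<close> no faster than linearly, with slope at least
  \<open>ln |f z| / (2 R)\<close>, whereas the slope at \<open>w\<close> is at most \<open>|f' w|\<close> because \<open>|f w| = 1\<close>. As \<open>z0\<close> lies
  outside the open disc, \<open>R \<le> |z - z0|\<close>.
\<close>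

lemma entire_exponential_growth:
  assumes hol: "f holomorphic_on UNIV"
    and der: "\<And>z. cmod (f z) = 1 \<Longrightarrow> cmod (deriv f z) \<le> K"
    and z0: "cmod (f z0) \<le> 1"
  shows "cmod (f z) \<le> exp (2 * \<bar>K\<bar> * dist z z0)"
proof (cases "cmod (f z) \<le> 1")
  case True
  also have "1 \<le> exp (2 * \<bar>K\<bar> * dist z z0)"
    by simp
  finally show ?thesis .
next
  case False
  define S where "S = {w. cmod (f w) \<le> 1}"
  have cont: "continuous_on UNIV f"
    using hol by (rule holomorphic_on_imp_continuous_on)
  have "closed S"
    unfolding S_def by (intro closed_Collect_le continuous_intros cont)
  moreover have "S \<noteq> {}"
    using z0 by (auto simp: S_def)
  ultimately obtain w where w: "w \<in> S" and near: "\<And>u. u \<in> S \<Longrightarrow> dist z w \<le> dist z u"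
    using distance_attains_inf[of S z] by metis
  define R where "R = dist z w"
  have outside: "cmod (f u) > 1" if "u \<in> ball z R" for u
    using near[of u] that by (force simp: S_def R_def)
  have "z \<noteq> w"
    using False w by (auto simp: S_def)
  then have R: "R > 0"
    by (simp add: R_def)
  \<comment> \<open>The radius from \<open>z\<close> to \<open>w\<close>, run through for \<open>t\<close> from \<open>0\<close> to \<open>1\<close>.\<close>
  define p where "p t = z + of_real t * (w - z)" for t :: real
  have dist_p: "cmod (p t - z) = t * R" if "0 \<le> t" for t
    using that by (simp add: p_def R_def norm_mult dist_norm norm_minus_commute)
  have p_ball: "p t \<in> ball z R" if "0 \<le> t" "t < 1" for t
    using dist_p[OF that(1)] that R by (simp add: dist_norm norm_minus_commute)
  obtain h where h: "h holomorphic_on ball z R" and exp_h: "\<And>u. u \<in> ball z R \<Longrightarrow> exp (h u) = f u"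
  proof (rule holomorphic_logarithm_exists[of "ball z R" f z])
    show "f holomorphic_on ball z R"
      using hol by (rule holomorphic_on_subset) auto
    show "f u \<noteq> 0" if "u \<in> ball z R" for u
      using outside[OF that] by auto
  qed (use R in auto)
  have norm_f: "cmod (f u) = exp (Re (h u))" if "u \<in> ball z R" for u
    using exp_h[OF that] norm_exp_eq_Re by metis
  have Re_h: "Re (h u) > 0" if "u \<in> ball z R" for u
    using outside[OF that] norm_f[OF that] by simp
  have p_lim: "(p \<longlongrightarrow> w) (at_left 1)"
    unfolding p_def by (auto intro!: tendsto_eq_intros)
  have inside_ev: "\<forall>\<^sub>F t in at_left 1. 0 < t \<and> t < (1::real)"
    using eventually_at_left_real[of 0 1] by (auto elim: eventually_mono)
  have p_ne: "p t \<noteq> w" if "t < 1" for t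
  proof
    assume "p t = w"
    then have "of_real (1 - t) * (w - z) = 0"
      by (simp add: p_def algebra_simps)
    then show False
      using that \<open>z \<noteq> w\<close> by auto
  qed
  have fw: "cmod (f w) = 1"
  proof (rule antisym)
    show "cmod (f w) \<le> 1"
      using w by (simp add: S_def)
    have "((\<lambda>t. cmod (f (p t))) \<longlongrightarrow> cmod (f w)) (at_left 1)"
      using p_lim cont by (intro tendsto_norm continuous_on_tendsto_compose[of UNIV f]) auto
    moreover have "\<forall>\<^sub>F t in at_left 1. 1 \<le> cmod (f (p t))"
      using inside_ev by eventually_elim (use p_ball outside in \<open>force intro: less_imp_le\<close>)
    ultimately show "1 \<le> cmod (f w)"
      by (intro tendsto_lowerbound[where F = "at_left (1::real)"]) auto
  qed
  have "(f has_field_derivative deriv f w) (at w)"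
    using hol by (intro holomorphic_derivI[of f UNIV]) auto
  then have "((\<lambda>u. (f u - f w) / (u - w)) \<longlongrightarrow> deriv f w) (at w)"
    by (simp add: has_field_derivative_iff)
  moreover have "filterlim p (at w) (at_left 1)"
    using p_lim p_ne by (auto simp: filterlim_at intro: eventually_mono[OF inside_ev])
  ultimately have "((\<lambda>t. (f (p t) - f w) / (p t - w)) \<longlongrightarrow> deriv f w) (at_left 1)"
    by (rule filterlim_compose)
  then have "((\<lambda>t. R * (1 + t) * cmod ((f (p t) - f w) / (p t - w))) \<longlongrightarrow> R * (1 + 1) * cmod (deriv f w)) (at_left 1)"
    by (intro tendsto_intros)
  moreover have "\<forall>\<^sub>F t in at_left 1. Re (h z) \<le> R * (1 + t) * cmod ((f (p t) - f w) / (p t - w))"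
    using inside_ev
  proof eventually_elim
    case (elim t)
    have pt: "p t \<in> ball z R"
      using elim by (intro p_ball) auto
    have "(R - cmod (p t - z)) * Re (h z) \<le> (R + cmod (p t - z)) * Re (h (p t))"
      by (rule Harnack_lower_bound[OF h Re_h pt])
    then have "R * ((1 - t) * Re (h z)) \<le> R * ((1 + t) * Re (h (p t)))"
      using dist_p[of t] elim by (simp add: algebra_simps)
    then have "(1 - t) * Re (h z) \<le> (1 + t) * Re (h (p t))"
      using R by (subst (asm) mult_le_cancel_left_pos)
    also have "Re (h (p t)) \<le> cmod (f (p t)) - 1"
      using exp_ge_add_one_self[of "Re (h (p t))"] unfolding norm_f[OF pt] by linarith
    also have "\<dots> \<le> cmod (f (p t) - f w)"
      using norm_triangle_ineq2[of "f (p t)" "f w"] fw by simp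
    finally have "(1 - t) * Re (h z) \<le> (1 + t) * cmod (f (p t) - f w)"
      using elim by (simp add: mult_left_mono)
    then have le: "Re (h z) \<le> (1 + t) * cmod (f (p t) - f w) / (1 - t)"
      using elim by (simp add: pos_le_divide_eq mult.commute)
    have "cmod (p t - w) = (1 - t) * R"
    proof -
      have "p t - w = of_real (1 - t) * (z - w)"
        by (simp add: p_def algebra_simps)
      then show ?thesis
        using elim by (simp only: norm_mult norm_of_real) (simp add: R_def dist_norm)
    qed
    then have "R * (1 + t) * cmod ((f (p t) - f w) / (p t - w)) = (1 + t) * cmod (f (p t) - f w) / (1 - t)"
      using R by (simp add: norm_divide)
    with le show ?case
      by simp
  qed
  ultimately have "Re (h z) \<le> R * (1 + 1) * cmod (deriv f w)"
    by (intro tendsto_lowerbound[where F = "at_left (1::real)"]) auto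
  also have "\<dots> \<le> R * (1 + 1) * \<bar>K\<bar>"
    using der[OF fw] R by (intro mult_left_mono) auto
  also have "\<dots> \<le> 2 * \<bar>K\<bar> * dist z z0"
    using near[of z0] z0 by (simp add: S_def R_def mult_left_mono mult.commute)
  finally show ?thesis
    using norm_f[of z] R by simp
qed

text \<open>
  The function that would arise as a limit of rescalings cannot exist. Its derivative is not
  constant: \<open>f\<close> would be a non-constant affine function, which has a zero, and the slope at that zero
  contradicts the bound \<open>M\<close>. So \<open>f'\<close> omits \<open>b\<close>, and \<open>f' = b + exp H\<close>. Since \<open>f\<close> has bounded spherical
  derivative it has exponential type, so \<open>H\<close> is affine and \<open>f z = b z + c + exp (\<alpha> z + \<beta>) / \<alpha>\<close>
  with \<open>\<alpha> \<noteq> 0\<close>. At a zero the exponential equals \<open>- \<alpha> (b z + c)\<close>, so that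
  \<open>f' z = b - \<alpha> (b z + c)\<close> there. As the zeros are unbounded, so is \<open>f'\<close> on them.
\<close>

lemma no_extremal_entire_function:
  assumes hol: "f holomorphic_on UNIV"
    and spherical: "\<And>z. cmod (deriv f z) \<le> C * (1 + (cmod (f z))\<^sup>2)"
    and zeros: "\<And>z. f z = 0 \<Longrightarrow> cmod (deriv f z) \<le> M"
    and omits: "(\<forall>z. deriv f z \<noteq> b) \<or> (\<forall>z. deriv f z = b)"
    and big: "M < cmod (deriv f 0)" "deriv f 0 \<noteq> 0"
    and b: "b \<noteq> 0"
  shows False
proof -
  have der: "(f has_field_derivative deriv f z) (at z)" for z
    using hol by (intro holomorphic_derivI[of f UNIV]) auto
  have not_affine: False if "\<And>z. deriv f z = k" for k
  proof -
    have "k \<noteq> 0"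
      using that big by auto
    have "((\<lambda>z. f z - k * z) has_field_derivative 0) (at z within UNIV)" for z
      using der[of z] that[of z] by (auto intro!: derivative_eq_intros)
    then obtain c where "\<And>z. f z - k * z = c"
      using has_field_derivative_zero_constant[of UNIV "\<lambda>z. f z - k * z"] by auto
    then have "f (- c / k) = 0"
      using \<open>k \<noteq> 0\<close> by (simp add: eq_diff_eq diff_eq_eq)
    then show False
      using zeros[of "- c / k"] that[of 0] that[of "- c / k"] big by simp
  qed
  have omits': "deriv f z \<noteq> b" for z
    using omits not_affine by blast
  obtain z0 where z0: "cmod (f z0) \<le> 1"
  proof -
    have False if large: "\<And>z. 1 < cmod (f z)"
    proof -
      have "f z \<noteq> 0" for z
        using large[of z] by auto
      then have "(\<lambda>z. inverse (f z)) holomorphic_on UNIV"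
        by (intro holomorphic_intros hol) auto
      moreover have "bounded (range (\<lambda>z. inverse (f z)))"
      proof -
        have "cmod (inverse (f z)) \<le> 1" for z
          using large[of z] by (simp add: norm_inverse inverse_le_1_iff less_imp_le)
        then show ?thesis
          by (auto simp: bounded_iff)
      qed
      ultimately obtain c where "\<And>z. inverse (f z) = c"
        using Liouville_theorem unfolding constant_on_def by blast
      then have "f = (\<lambda>z. inverse c)"
        by (metis inverse_inverse_eq)
      then show False
        using big(2) by simp
    qed
    then show ?thesis
      using that by (meson not_le)
  qed
  define L where "L = 4 * \<bar>C\<bar>"
  have growth: "cmod (f z) \<le> exp (L * dist z z0)" for z
  proof -
    have "cmod (deriv f u) \<le> 2 * C" if "cmod (f u) = 1" for u
      using spherical[of u] that by simp
    from entire_exponential_growth[OF hol this z0, of z] show ?thesis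
      by (simp add: L_def abs_mult)
  qed
  have growth': "cmod (deriv f z) \<le> exp (L * (dist z z0 + 1))" for z
  proof -
    have "cmod ((deriv ^^ 1) f z) \<le> fact 1 * exp (L * (dist z z0 + 1)) / 1 ^ 1"
    proof (rule Cauchy_inequality)
      show "f holomorphic_on ball z 1"
        using hol by (rule holomorphic_on_subset) auto
      show "continuous_on (cball z 1) f"
        by (intro holomorphic_on_imp_continuous_on holomorphic_on_subset[OF hol]) auto
      show "cmod (f u) \<le> exp (L * (dist z z0 + 1))" if "cmod (z - u) = 1" for u
      proof -
        have "dist u z0 \<le> dist z z0 + 1"
          using dist_triangle[of u z0 z] that by (simp add: dist_norm norm_minus_commute)
        then have "L * dist u z0 \<le> L * (dist z z0 + 1)"
          by (intro mult_left_mono) (auto simp: L_def)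
        then show ?thesis
          using growth[of u] by (meson exp_le_cancel_iff order_trans)
      qed
    qed auto
    then show ?thesis
      by simp
  qed
  have "(\<lambda>z. deriv f z - b) holomorphic_on UNIV"
    using hol by (intro holomorphic_intros) auto
  then obtain H where H: "H holomorphic_on UNIV" and exp_H: "\<And>z. exp (H z) = deriv f z - b"
    using holomorphic_logarithm_exists[of UNIV "\<lambda>z. deriv f z - b" 0] omits' by auto
  define C' where "C' = L * (cmod z0 + 1) + cmod b"
  have "Re (H z) \<le> C' * (1 + cmod z)" for z
  proof -
    let ?E = "L * (dist z z0 + 1)"
    have E: "0 \<le> ?E"
      by (simp add: L_def)
    have "exp (Re (H z)) = cmod (deriv f z - b)"
      using exp_H[of z] norm_exp_eq_Re by metis
    also have "\<dots> \<le> exp ?E + cmod b"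
      using norm_triangle_ineq4[of "deriv f z" b] growth'[of z] by linarith
    also have "\<dots> \<le> exp ?E + exp ?E * cmod b"
      using E by (intro add_left_mono) (simp add: mult_le_cancel_right1)
    also have "\<dots> = exp ?E * (1 + cmod b)"
      by (simp add: distrib_left)
    also have "\<dots> \<le> exp ?E * exp (cmod b)"
      by (intro mult_left_mono exp_ge_add_one_self) auto
    finally have "Re (H z) \<le> ?E + cmod b"
      by (simp flip: exp_add)
    also have "\<dots> \<le> L * (cmod z + cmod z0 + 1) + cmod b"
      using norm_triangle_ineq4[of z z0] by (auto simp: L_def dist_norm intro!: mult_left_mono)
    also have "\<dots> \<le> C' * (1 + cmod z)"
      unfolding C'_def L_def by (simp add: algebra_simps)
    finally show ?thesis .
  qed
  then obtain \<alpha> \<beta> where H_eq: "\<And>z. H z = \<alpha> * z + \<beta>"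
    using entire_linear_Re_bound_imp_affine[OF H] by blast
  have f': "deriv f z = b + exp (\<alpha> * z + \<beta>)" for z
    using exp_H[of z] H_eq[of z] by simp
  have \<alpha>: "\<alpha> \<noteq> 0"
    using not_affine[of "b + exp \<beta>"] f' by auto
  have "((\<lambda>z. f z - (b * z + exp (\<alpha> * z + \<beta>) / \<alpha>)) has_field_derivative 0) (at z within UNIV)" for z
    using der[of z] f'[of z] \<alpha> by (auto intro!: derivative_eq_intros)
  then obtain c where "\<And>z. f z - (b * z + exp (\<alpha> * z + \<beta>) / \<alpha>) = c"
    using has_field_derivative_zero_constant[of UNIV "\<lambda>z. f z - (b * z + exp (\<alpha> * z + \<beta>) / \<alpha>)"]
    by auto
  then have f_eq: "f z = b * z + c + exp (\<alpha> * z + \<beta>) / \<alpha>" for z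
    by (simp add: diff_eq_eq algebra_simps)
  \<comment> \<open>In terms of \<open>v = \<alpha> z + \<alpha> c / b\<close>, the equation \<open>f z = 0\<close> reads \<open>exp v = s v\<close> and \<open>f' z = b (1 - v)\<close>.\<close>
  define s where "s = - b * exp (\<alpha> * c / b - \<beta>)"
  obtain v where v: "exp v = s * v" "M / cmod b + 1 < cmod v"
    using exp_eq_linear_unbounded_solutions[of s] b unfolding s_def by auto
  define z where "z = v / \<alpha> - c / b"
  have "exp (\<alpha> * z + \<beta>) = exp v * exp (- (\<alpha> * c / b - \<beta>))"
    using \<alpha> by (simp add: z_def algebra_simps flip: exp_add)
  also have "\<dots> = - b * v"
    unfolding v(1) s_def by (simp add: exp_minus del: minus_diff_eq)
  finally have E: "exp (\<alpha> * z + \<beta>) = - b * v" .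
  have "f z = 0"
    using \<alpha> b unfolding f_eq E by (simp add: z_def field_simps)
  then have "cmod (b * (v - 1)) \<le> M"
    using zeros[of z] f'[of z] E norm_minus_commute[of b "b * v"] by (simp add: algebra_simps)
  then have "cmod (v - 1) \<le> M / cmod b"
    using b unfolding norm_mult by (simp add: pos_le_divide_eq mult.commute)
  then show False
    using v(2) norm_triangle_ineq2[of v 1] by simp
qed

section \<open>Marty's criterion for holomorphic functions\<close>

text \<open>
  \<open>1 - 2 / (1 + |u|\<^sup>2)\<close> is the height on the unit sphere of the stereographic projection of \<open>u\<close>. A
  bound for the spherical derivative makes this height Lipschitz along \<open>f\<close>, including at zeros of \<open>f\<close>,
  where \<open>|f|\<close> itself need not be differentiable.
\<close>

lemma chordal_height_lipschitz:
  assumes hol: "f holomorphic_on S" "open S" "convex S"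
    and der: "\<And>z. z \<in> S \<Longrightarrow> cmod (deriv f z) \<le> C * (1 + (cmod (f z))\<^sup>2)"
    and xy: "x \<in> S" "y \<in> S"
  shows "\<bar>2 / (1 + (cmod (f y))\<^sup>2) - 2 / (1 + (cmod (f x))\<^sup>2)\<bar> \<le> 2 * C * dist x y"
proof -
  define p where "p t = x + of_real t * (y - x)" for t :: real
  define F where "F t = f (p t)" for t
  define F' where "F' t = deriv f (p t) * (y - x)" for t
  have p_in: "p t \<in> S" if "t \<in> {0..1}" for t
  proof -
    have "(1 - t) *\<^sub>R x + t *\<^sub>R y \<in> S"
      using that xy by (intro convexD[OF hol(3)]) auto
    then show ?thesis
      by (simp add: p_def scaleR_conv_of_real algebra_simps)
  qed
  have F: "(F has_vector_derivative F' t) (at t within {0..1})" if "t \<in> {0..1}" for t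
  proof -
    have "(f has_field_derivative deriv f (p t)) (at (p t))"
      using hol p_in[OF that] by (intro holomorphic_derivI)
    moreover have "(p has_vector_derivative (y - x)) (at t within {0..1})"
      unfolding p_def by (auto intro!: derivative_eq_intros)
    ultimately show ?thesis
      using field_vector_diff_chain_within[of p "y - x" t "{0..1}" f "deriv f (p t)"]
      unfolding F_def F'_def by (simp add: o_def mult.commute has_field_derivative_at_within)
  qed
  define X where "X t = 2 / (1 + (cmod (F t))\<^sup>2)" for t
  define X' where "X' t = - (4 * (Re (F t) * Re (F' t) + Im (F t) * Im (F' t)) / (1 + (cmod (F t))\<^sup>2)\<^sup>2)" for t
  have pos: "1 + (cmod (F t))\<^sup>2 > 0" for t
    by (rule add_pos_nonneg) auto
  have X: "(X has_field_derivative X' t) (at t within {0..1})" if "t \<in> {0..1}" for t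
  proof -
    have "((\<lambda>t. Re (F t)) has_field_derivative Re (F' t)) (at t within {0..1})"
         "((\<lambda>t. Im (F t)) has_field_derivative Im (F' t)) (at t within {0..1})"
      using bounded_linear.has_vector_derivative[OF bounded_linear_Re F[OF that]]
        bounded_linear.has_vector_derivative[OF bounded_linear_Im F[OF that]]
      by (simp_all add: has_real_derivative_iff_has_vector_derivative)
    then have "((\<lambda>t. 1 + (cmod (F t))\<^sup>2) has_field_derivative
        2 * (Re (F t) * Re (F' t) + Im (F t) * Im (F' t))) (at t within {0..1})"
      unfolding cmod_power2
      by (intro DERIV_cong[OF DERIV_add[OF DERIV_const DERIV_add[OF DERIV_power DERIV_power]]])
         (auto simp: algebra_simps)
    from DERIV_cdivide[OF DERIV_inverse_fun[OF this], of "1/2"] show ?thesis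
      using pos[of t] unfolding X_def X'_def by (simp add: field_simps power2_eq_square)
  qed
  have "norm (X' t) \<le> 2 * C * dist x y" if "t \<in> {0..1}" for t
  proof -
    define u where "u = cmod (F t)"
    define q where "q = 1 + u\<^sup>2"
    have q: "0 < q" "2 * u \<le> q"
      using pos[of t] power2_diff[of 1 u] zero_le_power2[of "1 - u"] by (simp_all add: q_def u_def)
    have "cmod (F' t) \<le> C * q * dist x y"
      using mult_right_mono[OF der[OF p_in[OF that]], of "dist x y"]
      by (simp add: F'_def norm_mult dist_norm norm_minus_commute q_def u_def F_def)
    moreover have "\<bar>Re (F t) * Re (F' t) + Im (F t) * Im (F' t)\<bar> \<le> u * cmod (F' t)"
      using abs_Re_le_cmod[of "cnj (F t) * F' t"] by (simp add: norm_mult u_def)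
    ultimately have "\<bar>Re (F t) * Re (F' t) + Im (F t) * Im (F' t)\<bar> \<le> u * (C * q * dist x y)"
      by (smt (verit) mult_left_mono norm_ge_zero u_def)
    then have "4 * \<bar>Re (F t) * Re (F' t) + Im (F t) * Im (F' t)\<bar> \<le> (2 * u) * (2 * (C * q * dist x y))"
      by simp
    also have "\<dots> \<le> q * (2 * (C * q * dist x y))"
      using q(2) order_trans[OF norm_ge_zero \<open>cmod (F' t) \<le> C * q * dist x y\<close>]
      by (intro mult_right_mono) auto
    finally have "4 * \<bar>Re (F t) * Re (F' t) + Im (F t) * Im (F' t)\<bar> / q\<^sup>2 \<le> 2 * C * dist x y"
      using q(1) by (simp add: pos_divide_le_eq power2_eq_square algebra_simps)
    then show ?thesis
      by (simp add: X'_def abs_mult q_def u_def del: distrib_left_numeral)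
  qed
  then have "\<bar>X 1 - X 0\<bar> \<le> 2 * C * dist x y * \<bar>1 - 0\<bar>"
    using field_differentiable_bound[of "{0..1}" X X' "2 * C * dist x y" 1 0] X by auto
  then show ?thesis
    by (simp add: X_def F_def p_def)
qed

text \<open>
  On a small disc the height changes by at most \<open>1/2\<close>, so a function that takes a value in one
  hemisphere at the centre stays away from the pole of the other hemisphere.
\<close>

lemma bounded_or_bounded_below:
  assumes hol: "f holomorphic_on ball z0 s"
    and der: "\<And>z. z \<in> ball z0 s \<Longrightarrow> cmod (deriv f z) \<le> C * (1 + (cmod (f z))\<^sup>2)"
    and s: "4 * C * s \<le> 1"
  shows "(\<forall>z\<in>ball z0 s. cmod (f z) \<le> 2) \<or> (\<forall>z\<in>ball z0 s. 1/2 \<le> cmod (f z))"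
proof (cases "z0 \<in> ball z0 s")
  case False
  then show ?thesis
    by (metis ball_empty centre_in_ball empty_iff not_le)
next
  case True
  have C: "0 \<le> C"
  proof -
    have "0 \<le> C * (1 + (cmod (f z0))\<^sup>2)"
      using der[OF True] norm_ge_zero order_trans by blast
    moreover have "0 < 1 + (cmod (f z0))\<^sup>2"
      by (rule add_pos_nonneg) auto
    ultimately show ?thesis
      by (simp add: zero_le_mult_iff)
  qed
  define X where "X z = 2 / (1 + (cmod (f z))\<^sup>2)" for z
  have close: "\<bar>X z - X z0\<bar> \<le> 1/2" if z: "z \<in> ball z0 s" for z
  proof -
    have "\<bar>X z - X z0\<bar> \<le> 2 * C * dist z0 z"
      unfolding X_def by (rule chordal_height_lipschitz[OF hol _ _ der True z]) auto
    also have "\<dots> \<le> 2 * C * s"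
      using z C by (intro mult_left_mono) auto
    finally show ?thesis
      using s by simp
  qed
  have pos: "1 + (cmod (f z))\<^sup>2 > 0" for z
    by (rule add_pos_nonneg) auto
  show ?thesis
  proof (cases "cmod (f z0) \<le> 1")
    case small: True
    have "cmod (f z) \<le> 2" if z: "z \<in> ball z0 s" for z
    proof -
      have "(cmod (f z0))\<^sup>2 \<le> 1"
        using small by (simp add: power_le_one)
      then have "1 \<le> X z0"
        using pos[of z0] by (simp add: X_def)
      then have "1/2 \<le> X z"
        using close[OF z] by linarith
      then have "(cmod (f z))\<^sup>2 \<le> 2\<^sup>2"
        using pos[of z] by (simp add: X_def field_simps)
      then show ?thesis
        by (rule power2_le_imp_le) simp
    qed
    then show ?thesis
      by blast
  next
    case large: False
    have "1/2 \<le> cmod (f z)" if z: "z \<in> ball z0 s" for z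
    proof -
      have "1 \<le> (cmod (f z0))\<^sup>2"
        using large by (simp add: one_le_power)
      then have "X z0 \<le> 1"
        using pos[of z0] by (simp add: X_def)
      then have "X z \<le> 3/2"
        using close[OF z] by linarith
      then have "(1/2)\<^sup>2 \<le> (cmod (f z))\<^sup>2"
        using pos[of z] by (simp add: X_def field_simps)
      then show ?thesis
        by (rule power2_le_imp_le) simp
    qed
    then show ?thesis
      by blast
  qed
qed

definition unif_infinite_on :: "complex set \<Rightarrow> (nat \<Rightarrow> complex \<Rightarrow> complex) \<Rightarrow> bool" where
  "unif_infinite_on U F \<longleftrightarrow> (\<forall>M. \<forall>\<^sub>F n in sequentially. \<forall>z\<in>U. M < cmod (F n z))"

text \<open>
  Spherical limits of holomorphic functions are locally either holomorphic or identically infinite,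
  so that no values at isolated poles have to be described.
\<close>

definition sphere_limit_on :: "complex set \<Rightarrow> (nat \<Rightarrow> complex \<Rightarrow> complex) \<Rightarrow> bool" where
  "sphere_limit_on U F \<longleftrightarrow>
     (\<exists>h. h holomorphic_on U \<and> uniform_limit U F h sequentially) \<or> unif_infinite_on U F"

text \<open>
  A subsequence consists of functions that are all bounded by \<open>2\<close> or all bounded below by \<open>1/2\<close> in
  modulus. In the second case Montel's theorem is applied to the reciprocals. They have no zeros, so by
  Hurwitz' theorem their limit vanishes nowhere or identically; the original functions then converge
  to its reciprocal or to infinity, respectively.
\<close>

lemma Marty_on_small_ball:
  fixes F :: "nat \<Rightarrow> complex \<Rightarrow> complex"
  assumes hol: "\<And>n. F n holomorphic_on ball z0 s"
    and der: "\<And>n z. z \<in> ball z0 s \<Longrightarrow> cmod (deriv (F n) z) \<le> C * (1 + (cmod (F n z))\<^sup>2)"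
    and s: "0 < s" "4 * C * s \<le> 1"
  obtains k where "strict_mono (k :: nat \<Rightarrow> nat)" "sphere_limit_on (ball z0 (s/2)) (F \<circ> k)"
proof -
  let ?B = "ball z0 s"
  let ?U = "ball z0 (s/2)" and ?U' = "cball z0 (s/2)"
  have U': "compact ?U'" "?U' \<subseteq> ?B" "?U \<subseteq> ?U'" "?U \<subseteq> ?B"
    using s by auto
  define N where "N = {n. \<forall>z\<in>?B. cmod (F n z) \<le> 2}"
  have big: "1/2 \<le> cmod (F n z)" if "n \<notin> N" "z \<in> ?B" for n z
    using bounded_or_bounded_below[OF hol der s(2), of n] that unfolding N_def by blast
  show ?thesis
  proof (cases "infinite N")
    case True
    then obtain j where j: "strict_mono (j :: nat \<Rightarrow> nat)" "\<And>n. j n \<in> N"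
      using infinite_enumerate by blast
    define \<H> where "\<H> = range (F \<circ> j)"
    obtain h r where h: "h holomorphic_on ?B" and r: "strict_mono (r :: nat \<Rightarrow> nat)"
      and ul: "\<And>K. compact K \<Longrightarrow> K \<subseteq> ?B \<Longrightarrow> uniform_limit K ((F \<circ> j) \<circ> r) h sequentially"
    proof (rule Montel[of ?B \<H> "F \<circ> j"])
      show "\<exists>B. \<forall>h\<in>\<H>. \<forall>z\<in>K. cmod (h z) \<le> B" if "compact K" "K \<subseteq> ?B" for K
        using that j(2) unfolding \<H>_def N_def by fastforce
    qed (use hol in \<open>auto simp: \<H>_def\<close>)
    have "uniform_limit ?U (F \<circ> (j \<circ> r)) h sequentially"
      using uniform_limit_on_subset[OF ul[OF U'(1,2)] U'(3)] by (simp add: o_assoc)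
    then show ?thesis
      using that[of "j \<circ> r"] j(1) r h U'(4) strict_mono_o holomorphic_on_subset
      unfolding sphere_limit_on_def by blast
  next
    case False
    then have "infinite (- N)"
      by (simp add: Compl_eq_Diff_UNIV)
    then obtain j where j: "strict_mono (j :: nat \<Rightarrow> nat)" "\<And>n. j n \<in> - N"
      using infinite_enumerate by blast
    define G where "G n z = inverse (F (j n) z)" for n z
    have F_big: "1/2 \<le> cmod (F (j n) z)" if "z \<in> ?B" for n z
      using big that j(2) by blast
    have F_nz: "F (j n) z \<noteq> 0" if "z \<in> ?B" for n z
      using F_big[OF that, of n] by auto
    have G_hol: "G n holomorphic_on ?B" for n
      unfolding G_def using F_nz by (intro holomorphic_intros hol) auto
    have G_le: "cmod (G n z) \<le> 2" if "z \<in> ?B" for n z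
      using F_big[OF that, of n] le_imp_inverse_le[of "1/2" "cmod (F (j n) z)"]
      by (simp add: G_def norm_inverse)
    define \<H> where "\<H> = range G"
    obtain \<phi> r where \<phi>: "\<phi> holomorphic_on ?B" and r: "strict_mono (r :: nat \<Rightarrow> nat)"
      and ul: "\<And>K. compact K \<Longrightarrow> K \<subseteq> ?B \<Longrightarrow> uniform_limit K (G \<circ> r) \<phi> sequentially"
    proof (rule Montel[of ?B \<H> G])
      show "\<exists>B. \<forall>h\<in>\<H>. \<forall>z\<in>K. cmod (h z) \<le> B" if "compact K" "K \<subseteq> ?B" for K
        using that G_le unfolding \<H>_def by fastforce
    qed (use G_hol in \<open>auto simp: \<H>_def\<close>)
    have ulU: "uniform_limit ?U' (G \<circ> r) \<phi> sequentially"
      by (rule ul[OF U'(1,2)])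
    have "sphere_limit_on ?U (F \<circ> (j \<circ> r))"
    proof (cases "\<exists>z\<in>?B. \<phi> z = 0")
      case True
      have "\<phi> constant_on ?B"
      proof (rule ccontr)
        assume nc: "\<not> \<phi> constant_on ?B"
        have "\<phi> z \<noteq> 0" if "z \<in> ?B" for z
          by (rule Hurwitz_no_zeros[of ?B "G \<circ> r" \<phi>, OF _ _ _ \<phi> ul nc _ that])
             (use G_hol F_nz in \<open>auto simp: G_def\<close>)
        then show False
          using True by blast
      qed
      then have zero: "\<phi> z = 0" if "z \<in> ?B" for z
        using True that unfolding constant_on_def by metis
      have "unif_infinite_on ?U (F \<circ> (j \<circ> r))"
        unfolding unif_infinite_on_def
      proof
        fix M :: real
        have "\<forall>\<^sub>F n in sequentially. \<forall>z\<in>?U'. dist ((G \<circ> r) n z) (\<phi> z) < 1 / (\<bar>M\<bar> + 1)"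
          by (intro uniform_limitD[OF ulU]) auto
        then show "\<forall>\<^sub>F n in sequentially. \<forall>z\<in>?U. M < cmod ((F \<circ> (j \<circ> r)) n z)"
        proof eventually_elim
          case (elim n)
          show ?case
          proof
            fix z assume z: "z \<in> ?U"
            then have "cmod (inverse (F (j (r n)) z)) < 1 / (\<bar>M\<bar> + 1)"
              using elim[rule_format, of z] U'(3,4) zero[of z] by (auto simp: G_def)
            then have "inverse (cmod (F (j (r n)) z)) < inverse (\<bar>M\<bar> + 1)"
              by (simp only: norm_inverse inverse_eq_divide norm_divide norm_one)
            moreover have "0 < cmod (F (j (r n)) z)"
              using F_nz[of z "r n"] z U'(4) by auto
            ultimately have "\<bar>M\<bar> + 1 < cmod (F (j (r n)) z)"
              by (rule inverse_less_imp_less)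
            then show "M < cmod ((F \<circ> (j \<circ> r)) n z)"
              by simp
          qed
        qed
      qed
      then show ?thesis
        by (simp add: sphere_limit_on_def)
    next
      case False
      have "continuous_on ?U' (\<lambda>z. cmod (\<phi> z))"
        using \<phi> U'(2) by (intro continuous_intros holomorphic_on_imp_continuous_on holomorphic_on_subset[OF \<phi>])
      then obtain w where w: "w \<in> ?U'" "\<And>z. z \<in> ?U' \<Longrightarrow> cmod (\<phi> w) \<le> cmod (\<phi> z)"
        using continuous_attains_inf[OF U'(1), of "\<lambda>z. cmod (\<phi> z)"] s by auto
      \<comment> \<open>A positive lower bound for \<open>|\<phi>|\<close> makes the passage to reciprocals uniform.\<close>
      have "cmod (\<phi> w) > 0"
        using False w(1) U'(2) by auto
      then have "uniform_limit ?U' (\<lambda>n z. inverse ((G \<circ> r) n z)) (inverse \<circ> \<phi>) sequentially"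
        using w(2) by (intro uniform_lim_inverse[OF ulU]) auto
      then have "uniform_limit ?U (F \<circ> (j \<circ> r)) (\<lambda>z. inverse (\<phi> z)) sequentially"
        using uniform_limit_on_subset[OF _ U'(3)] by (auto simp: G_def o_def)
      moreover have "(\<lambda>z. inverse (\<phi> z)) holomorphic_on ?U"
        using False U'(4) by (intro holomorphic_intros holomorphic_on_subset[OF \<phi>]) auto
      ultimately show ?thesis
        unfolding sphere_limit_on_def by blast
    qed
    then show ?thesis
      using that[of "j \<circ> r"] j(1) r strict_mono_o by blast
  qed
qed

lemma sphere_limit_on_subsequence:
  assumes lim: "sphere_limit_on U (F \<circ> k1)"
    and tail: "\<And>j. N \<le> j \<Longrightarrow> \<exists>j'\<ge>j. k2 j = k1 j'"
  shows "sphere_limit_on U (F \<circ> k2)"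
proof -
  have transfer: "\<forall>\<^sub>F n in sequentially. P (k2 n)" if P: "\<forall>\<^sub>F n in sequentially. P (k1 n)" for P
  proof -
    obtain n0 where "\<And>n. n0 \<le> n \<Longrightarrow> P (k1 n)"
      using P by (auto simp: eventually_sequentially)
    then have "P (k2 n)" if "max n0 N \<le> n" for n
      using tail[of n] that by force
    then show ?thesis
      by (rule eventually_sequentiallyI)
  qed
  from lim show ?thesis
    unfolding sphere_limit_on_def
  proof (elim disj_forward exE conjE)
    fix h assume h: "h holomorphic_on U" "uniform_limit U (F \<circ> k1) h sequentially"
    have "uniform_limit U (F \<circ> k2) h sequentially"
    proof (rule uniform_limitI)
      fix e :: real assume "e > 0"
      then have "\<forall>\<^sub>F n in sequentially. \<forall>z\<in>U. dist (F (k1 n) z) (h z) < e"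
        using uniform_limitD[OF h(2)] by simp
      from transfer[OF this] show "\<forall>\<^sub>F n in sequentially. \<forall>z\<in>U. dist ((F \<circ> k2) n z) (h z) < e"
        by simp
    qed
    with h(1) show "\<exists>h. h holomorphic_on U \<and> uniform_limit U (F \<circ> k2) h sequentially"
      by blast
  next
    assume inf: "unif_infinite_on U (F \<circ> k1)"
    show "unif_infinite_on U (F \<circ> k2)"
      unfolding unif_infinite_on_def
    proof
      fix M
      have "\<forall>\<^sub>F n in sequentially. \<forall>z\<in>U. M < cmod (F (k1 n) z)"
        using inf by (simp add: unif_infinite_on_def)
      from transfer[OF this] show "\<forall>\<^sub>F n in sequentially. \<forall>z\<in>U. M < cmod ((F \<circ> k2) n z)"
        by simp
    qed
  qed
qed

text \<open>
  A diagonal sequence over countably many small discs that cover \<open>D\<close>. The bound is only asked for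
  eventually, so that the functions may be defined on growing subdomains of \<open>D\<close>, as rescaled functions
  are.
\<close>

lemma Marty_local_convergence:
  fixes F :: "nat \<Rightarrow> complex \<Rightarrow> complex"
  assumes "open D" "D \<noteq> {}"
    and local_bound: "\<And>z. z \<in> D \<Longrightarrow> \<exists>s>0. \<exists>C. ball z s \<subseteq> D \<and> (\<forall>\<^sub>F n in sequentially.
        F n holomorphic_on ball z s \<and> (\<forall>w\<in>ball z s. cmod (deriv (F n) w) \<le> C * (1 + (cmod (F n w))\<^sup>2)))"
  obtains k where "strict_mono (k :: nat \<Rightarrow> nat)"
    "\<And>z. z \<in> D \<Longrightarrow> \<exists>U. open U \<and> z \<in> U \<and> U \<subseteq> D \<and> sphere_limit_on U (F \<circ> k)"
proof -
  define good where "good s C z n \<longleftrightarrow> F n holomorphic_on ball z s \<and>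
    (\<forall>w\<in>ball z s. cmod (deriv (F n) w) \<le> C * (1 + (cmod (F n w))\<^sup>2))" for s C z n
  have "\<exists>s>0. \<exists>C. ball z s \<subseteq> D \<and> 4 * C * s \<le> 1 \<and> (\<forall>\<^sub>F n in sequentially. good s C z n)"
    if z: "z \<in> D" for z
  proof -
    obtain s C where s: "s > 0" "ball z s \<subseteq> D" "\<forall>\<^sub>F n in sequentially. good s C z n"
      using local_bound[OF z] unfolding good_def by blast
    define s' where "s' = min s (1 / (4 * (\<bar>C\<bar> + 1)))"
    have "s' > 0"
      using s(1) by (simp add: s'_def)
    moreover have sub: "ball z s' \<subseteq> ball z s"
      by (auto simp: s'_def)
    moreover have "4 * C * s' \<le> 1"
    proof -
      have "4 * C * s' \<le> (4 * (\<bar>C\<bar> + 1)) * s'"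
        using \<open>s' > 0\<close> by (intro mult_right_mono) auto
      also have "\<dots> \<le> (4 * (\<bar>C\<bar> + 1)) * (1 / (4 * (\<bar>C\<bar> + 1)))"
        by (intro mult_left_mono) (auto simp: s'_def)
      also have "\<dots> = 1"
        by simp
      finally show ?thesis .
    qed
    moreover have "\<forall>\<^sub>F n in sequentially. good s' C z n"
      using s(3) by eventually_elim (use sub holomorphic_on_subset in \<open>auto simp: good_def\<close>)
    ultimately show ?thesis
      using s(2) by blast
  qed
  then obtain s C where s: "\<And>z. z \<in> D \<Longrightarrow> s z > 0" "\<And>z. z \<in> D \<Longrightarrow> ball z (s z) \<subseteq> D"
    "\<And>z. z \<in> D \<Longrightarrow> 4 * C z * s z \<le> 1"
    and ev_good: "\<And>z. z \<in> D \<Longrightarrow> \<forall>\<^sub>F n in sequentially. good (s z) (C z) z n"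
    by metis
  define U where "U z = ball z (s z / 2)" for z
  have U: "z \<in> U z" "U z \<subseteq> D" if "z \<in> D" for z
    using s(1,2)[OF that] by (auto simp: U_def)
  obtain \<U> where \<U>: "\<U> \<subseteq> U ` D" "countable \<U>" "\<Union>\<U> = \<Union>(U ` D)"
    using Lindelof[of "U ` D"] by (auto simp: U_def)
  then obtain Z where Z: "Z \<subseteq> D" "countable Z" "\<U> = U ` Z"
    by (meson countable_subset_image)
  have "Z \<noteq> {}"
    using \<U>(3) U(1) \<open>D \<noteq> {}\<close> unfolding Z(3) by blast
  define c where "c = from_nat_into Z"
  have c: "range c = Z"
    unfolding c_def using \<open>Z \<noteq> {}\<close> Z(2) by (rule range_from_nat_into)
  \<comment> \<open>The diagonal argument ranges over all index sequences \<open>r\<close>, along which the bound may fail. The first alternative covers these: it is inherited by subsequences, and impossible for strictly increasing \<open>r\<close>.\<close>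
  define P where "P i r \<longleftrightarrow> (\<forall>\<^sub>F n in sequentially. \<not> good (s (c i)) (C (c i)) (c i) (r n)) \<or>
      sphere_limit_on (U (c i)) (F \<circ> r)" for i and r :: "nat \<Rightarrow> nat"
  have cD: "c i \<in> D" for i
    using c Z(1) by blast
  obtain k where k: "strict_mono (k :: nat \<Rightarrow> nat)" "\<And>i. P i (id \<circ> k)"
  proof (rule subsequence_diagonalization_lemma[of P id])
    show "\<exists>k. strict_mono (k :: nat \<Rightarrow> nat) \<and> P i (r \<circ> k)" for i r
    proof (cases "finite {n. good (s (c i)) (C (c i)) (c i) (r n)}")
      case True
      then have "\<forall>\<^sub>F n in sequentially. \<not> good (s (c i)) (C (c i)) (c i) (r n)"
        unfolding cofinite_eq_sequentially[symmetric] eventually_cofinite by simp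
      then have "P i (r \<circ> id)"
        by (simp add: P_def)
      then show ?thesis
        using strict_mono_id by blast
    next
      case False
      then obtain j where j: "strict_mono (j :: nat \<Rightarrow> nat)"
        "\<And>n. good (s (c i)) (C (c i)) (c i) (r (j n))"
        using infinite_enumerate[of "{n. good (s (c i)) (C (c i)) (c i) (r n)}"] by blast
      obtain l where l: "strict_mono (l :: nat \<Rightarrow> nat)"
        "sphere_limit_on (ball (c i) (s (c i) / 2)) ((\<lambda>n. F (r (j n))) \<circ> l)"
      proof (rule Marty_on_small_ball[of "\<lambda>n. F (r (j n))" "c i" "s (c i)" "C (c i)"])
      qed (use j(2) s(1,3)[OF cD[of i]] in \<open>auto simp: good_def\<close>)
      then have "P i (r \<circ> (j \<circ> l))"
        by (simp add: P_def U_def o_def)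
      then show ?thesis
        using strict_mono_o[OF j(1) l(1)] by blast
    qed
    show "P i (r \<circ> k2)" if P: "P i (r \<circ> k1)" and tail: "\<And>j. N \<le> j \<Longrightarrow> \<exists>j'. j \<le> j' \<and> k2 j = k1 j'"
      for i r k1 k2 N
      using P unfolding P_def
    proof (elim disj_forward)
      assume "\<forall>\<^sub>F n in sequentially. \<not> good (s (c i)) (C (c i)) (c i) ((r \<circ> k1) n)"
      then obtain n0 where n0: "\<And>n. n0 \<le> n \<Longrightarrow> \<not> good (s (c i)) (C (c i)) (c i) (r (k1 n))"
        by (auto simp: eventually_sequentially)
      have "\<not> good (s (c i)) (C (c i)) (c i) (r (k2 n))" if "max n0 N \<le> n" for n
        using tail[of n] that n0 by force
      then show "\<forall>\<^sub>F n in sequentially. \<not> good (s (c i)) (C (c i)) (c i) ((r \<circ> k2) n)"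
        unfolding o_def by (rule eventually_sequentiallyI)
    next
      assume "sphere_limit_on (U (c i)) (F \<circ> (r \<circ> k1))"
      then show "sphere_limit_on (U (c i)) (F \<circ> (r \<circ> k2))"
        using sphere_limit_on_subsequence[of "U (c i)" "F \<circ> r" k1 N k2] tail by (simp add: o_assoc)
    qed
  qed blast
  have limit: "sphere_limit_on (U (c i)) (F \<circ> k)" for i
  proof -
    have "\<not> (\<forall>\<^sub>F n in sequentially. \<not> good (s (c i)) (C (c i)) (c i) (k n))"
    proof
      assume "\<forall>\<^sub>F n in sequentially. \<not> good (s (c i)) (C (c i)) (c i) (k n)"
      with eventually_subseq[OF k(1) ev_good[OF cD[of i]]]
      have "\<forall>\<^sub>F n in sequentially. False"
        by eventually_elim simp
      then show False
        by simp
    qed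
    then show ?thesis
      using k(2)[of i] by (auto simp: P_def o_def)
  qed
  show ?thesis
  proof
    fix z assume "z \<in> D"
    then have "z \<in> \<Union>(U ` Z)"
      using U(1) \<U>(3) unfolding Z(3) by blast
    then obtain i where "z \<in> U (c i)"
      using c by blast
    then show "\<exists>V. open V \<and> z \<in> V \<and> V \<subseteq> D \<and> sphere_limit_on V (F \<circ> k)"
      using U(2)[OF cD] limit[of i] by (intro exI[of _ "U (c i)"]) (auto simp: U_def)
  qed (rule k(1))
qed

definition locally_uniform_limit_on :: "complex set \<Rightarrow> (nat \<Rightarrow> complex \<Rightarrow> complex) \<Rightarrow> (complex \<Rightarrow> complex) \<Rightarrow> bool" where
  "locally_uniform_limit_on D F h \<longleftrightarrow>
     (\<forall>z\<in>D. \<exists>U. open U \<and> z \<in> U \<and> U \<subseteq> D \<and> uniform_limit U F h sequentially)"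

definition locally_unif_infinite_on :: "complex set \<Rightarrow> (nat \<Rightarrow> complex \<Rightarrow> complex) \<Rightarrow> bool" where
  "locally_unif_infinite_on D F \<longleftrightarrow>
     (\<forall>z\<in>D. \<exists>U. open U \<and> z \<in> U \<and> U \<subseteq> D \<and> unif_infinite_on U F)"

text \<open>
  The points with a finite limit near them and the points with limit infinity near them form two
  disjoint open sets, so connectedness leaves only one kind.
\<close>

lemma Marty_criterion:
  fixes F :: "nat \<Rightarrow> complex \<Rightarrow> complex"
  assumes "open D" "connected D" "D \<noteq> {}"
    and local_bound: "\<And>z. z \<in> D \<Longrightarrow> \<exists>s>0. \<exists>C. ball z s \<subseteq> D \<and> (\<forall>\<^sub>F n in sequentially.
        F n holomorphic_on ball z s \<and> (\<forall>w\<in>ball z s. cmod (deriv (F n) w) \<le> C * (1 + (cmod (F n w))\<^sup>2)))"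
  obtains k where "strict_mono (k :: nat \<Rightarrow> nat)"
    "(\<exists>h. h holomorphic_on D \<and> locally_uniform_limit_on D (F \<circ> k) h) \<or> locally_unif_infinite_on D (F \<circ> k)"
proof -
  obtain k where k: "strict_mono (k :: nat \<Rightarrow> nat)"
    and loc: "\<And>z. z \<in> D \<Longrightarrow> \<exists>U. open U \<and> z \<in> U \<and> U \<subseteq> D \<and> sphere_limit_on U (F \<circ> k)"
    using Marty_local_convergence[OF assms(1,3) local_bound] by blast
  define near where "near = \<Union>{U. open U \<and> U \<subseteq> D \<and> (\<exists>g. g holomorphic_on U \<and> uniform_limit U (F \<circ> k) g sequentially)}"
  define far where "far = \<Union>{U. open U \<and> U \<subseteq> D \<and> unif_infinite_on U (F \<circ> k)}"
  have opens: "open near" "open far"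
    unfolding near_def far_def by auto
  have cover: "D \<subseteq> near \<union> far"
  proof
    fix z assume "z \<in> D"
    then obtain U where "open U" "z \<in> U" "U \<subseteq> D" "sphere_limit_on U (F \<circ> k)"
      using loc by auto
    then show "z \<in> near \<union> far"
      by (auto simp: sphere_limit_on_def near_def far_def)
  qed
  have disjoint: "near \<inter> far \<inter> D = {}"
  proof -
    have False if z: "z \<in> near" "z \<in> far" for z
    proof -
      obtain U g where zU: "z \<in> U" and ul: "uniform_limit U (F \<circ> k) g sequentially"
        using z(1) by (auto simp: near_def)
      have "(\<lambda>n. (F \<circ> k) n z) \<longlonglongrightarrow> g z"
        by (rule tendsto_uniform_limitI[OF ul zU])
      then have "\<forall>\<^sub>F n in sequentially. dist ((F \<circ> k) n z) (g z) < 1"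
        by (rule tendstoD) simp
      moreover have "\<forall>\<^sub>F n in sequentially. cmod (g z) + 1 < cmod ((F \<circ> k) n z)"
      proof -
        obtain V where V: "z \<in> V" "unif_infinite_on V (F \<circ> k)"
          using z(2) by (auto simp: far_def)
        have "\<forall>\<^sub>F n in sequentially. \<forall>w\<in>V. cmod (g z) + 1 < cmod ((F \<circ> k) n w)"
          using V(2) by (simp add: unif_infinite_on_def)
        then show ?thesis
          by (rule eventually_mono) (use V(1) in auto)
      qed
      ultimately have "\<forall>\<^sub>F n in sequentially. False"
      proof eventually_elim
        case (elim n)
        then show False
          using norm_triangle_sub[of "(F \<circ> k) n z" "g z"] by (simp add: dist_norm)
      qed
      then show False
        by simp
    qed
    then show ?thesis
      by blast
  qed
  consider "near \<inter> D = {}" | "far \<inter> D = {}"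
    using connectedD[OF \<open>connected D\<close> opens disjoint cover] by blast
  then have "(\<exists>h. h holomorphic_on D \<and> locally_uniform_limit_on D (F \<circ> k) h) \<or> locally_unif_infinite_on D (F \<circ> k)"
  proof cases
    case 1
    then have "D \<subseteq> far"
      using cover by blast
    then have "locally_unif_infinite_on D (F \<circ> k)"
      unfolding locally_unif_infinite_on_def
    proof (intro ballI)
      fix z assume "z \<in> D"
      then have "z \<in> far"
        using \<open>D \<subseteq> far\<close> by auto
      then obtain U where "U \<in> {U. open U \<and> U \<subseteq> D \<and> unif_infinite_on U (F \<circ> k)}" "z \<in> U"
        unfolding far_def by (elim UnionE)
      then show "\<exists>U. open U \<and> z \<in> U \<and> U \<subseteq> D \<and> unif_infinite_on U (F \<circ> k)"
        by (intro exI[of _ U]) simp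
    qed
    then show ?thesis ..
  next
    case 2
    define h where "h z = lim (\<lambda>n. (F \<circ> k) n z)" for z
    have h: "\<exists>U. open U \<and> z \<in> U \<and> U \<subseteq> D \<and> h holomorphic_on U \<and> uniform_limit U (F \<circ> k) h sequentially"
      if "z \<in> D" for z
    proof -
      have "z \<in> near"
        using 2 cover that by auto
      then obtain U g where U: "open U" "z \<in> U" "U \<subseteq> D" "g holomorphic_on U"
        and ul: "uniform_limit U (F \<circ> k) g sequentially"
        by (auto simp: near_def)
      have "h w = g w" if "w \<in> U" for w
        unfolding h_def using tendsto_uniform_limitI[OF ul that] by (rule limI)
      then have hg: "g w = h w" if "w \<in> U" for w
        using that by simp
      have "h holomorphic_on U"
        using U(4) hg by (rule holomorphic_transform)
      moreover have "uniform_limit U (F \<circ> k) h sequentially"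
        using ul uniform_limit_cong'[of U "F \<circ> k" "F \<circ> k" g h sequentially] hg by simp
      ultimately show ?thesis
        using U by (intro exI[of _ U]) simp
    qed
    have "h field_differentiable at z within D" if zD: "z \<in> D" for z
    proof -
      obtain U where "open U" "z \<in> U" "h holomorphic_on U"
        using h[OF zD] by auto
      then have "h field_differentiable at z"
        by (rule holomorphic_on_imp_differentiable_at[rotated])
      then show ?thesis
        by (rule field_differentiable_at_within)
    qed
    then have "h holomorphic_on D"
      unfolding holomorphic_on_def by blast
    moreover have "locally_uniform_limit_on D (F \<circ> k) h"
      unfolding locally_uniform_limit_on_def
    proof
      fix z assume "z \<in> D"
      from h[OF this] show "\<exists>U. open U \<and> z \<in> U \<and> U \<subseteq> D \<and> uniform_limit U (F \<circ> k) h sequentially"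
        by (elim exE) (intro exI, auto)
    qed
    ultimately show ?thesis
      by (intro disjI1 exI[of _ h]) simp
  qed
  then show ?thesis
    by (rule that[OF k])
qed

section \<open>Rescaling\<close>

text \<open>
  Near a zero of \<open>g\<close> the numerator vanishes, because there \<open>|g'| < K\<close>. Hence the quotient is continuous
  at the zeros too.
\<close>

lemma continuous_on_excess_quotient:
  assumes S: "open S" and hol: "g holomorphic_on S"
    and zeros: "\<And>z. z \<in> S \<Longrightarrow> g z = 0 \<Longrightarrow> cmod (deriv g z) < K"
  shows "continuous_on S (\<lambda>z. max 0 (cmod (deriv g z) - K) / (cmod (g z))\<^sup>2)"
proof -
  have cont: "continuous_on S g" "continuous_on S (deriv g)"
    using holomorphic_on_imp_continuous_on[OF hol]
      holomorphic_on_imp_continuous_on[OF holomorphic_deriv[OF hol S]] by simp_all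
  define S1 where "S1 = {z \<in> S. g z \<noteq> 0}"
  define S2 where "S2 = {z \<in> S. cmod (deriv g z) < K}"
  have "open S1"
    using continuous_open_preimage[OF cont(1) S, of "- {0}"]
    by (auto simp: S1_def vimage_def Int_def)
  moreover have "open S2"
    using continuous_open_preimage[OF continuous_on_norm[OF cont(2)] S, of "{..<K}"]
    by (auto simp: S2_def vimage_def Int_def)
  moreover have "continuous_on S1 (\<lambda>z. max 0 (cmod (deriv g z) - K) / (cmod (g z))\<^sup>2)"
    by (intro continuous_intros continuous_on_subset[OF cont(1)] continuous_on_subset[OF cont(2)])
       (auto simp: S1_def)
  moreover have "continuous_on S2 (\<lambda>z. max 0 (cmod (deriv g z) - K) / (cmod (g z))\<^sup>2)"
    by (rule continuous_on_eq[of _ "\<lambda>_. 0"]) (auto simp: S2_def)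
  ultimately have "continuous_on (S1 \<union> S2) (\<lambda>z. max 0 (cmod (deriv g z) - K) / (cmod (g z))\<^sup>2)"
    by (rule continuous_on_open_Un)
  moreover have "S1 \<union> S2 = S"
    using zeros by (auto simp: S1_def S2_def)
  ultimately show ?thesis
    by simp
qed

text \<open>
  A rescaling lemma of Zalcman-Pang type, with the quotient \<open>g (c + \<rho> \<zeta>) / \<rho>\<close> in mind. For a given
  \<open>z\<close> the scale \<open>\<rho>\<close> at which this rescaling of \<open>g\<close> about \<open>z\<close> has spherical derivative exactly \<open>K\<close> at
  the origin is \<open>sqrt (K / \<phi> z)\<close> if \<open>\<phi> z > 0\<close>, where \<open>\<phi> = max 0 (|g'| - K) / |g|\<^sup>2\<close>. The centre \<open>c\<close> maximises
  \<open>(r - |z - z0|)\<^sup>2 \<phi> z\<close>, the square of the ratio of the distance to the boundary and the scale, up to the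
  factor \<open>K\<close>. Moving from \<open>c\<close> by at most half the distance to the boundary then increases \<open>\<phi>\<close> by
  at most the factor \<open>4\<close>, and the point \<open>w\<close> shows that the ratio is large when \<open>C\<close> is.
\<close>

lemma rescaling_centre:
  assumes S: "open S" "cball z0 r \<subseteq> S" and hol: "g holomorphic_on S" and K: "0 < K"
    and zeros: "\<And>z. z \<in> S \<Longrightarrow> g z = 0 \<Longrightarrow> cmod (deriv g z) < K"
    and w: "w \<in> ball z0 (r/2)" and C: "0 \<le> C"
    and large: "K + C * (cmod (g w))\<^sup>2 < cmod (deriv g w)"
  obtains c \<rho> where "0 < \<rho>" "dist z0 c < r" "(r/2)\<^sup>2 * C \<le> K * ((r - dist z0 c) / \<rho>)\<^sup>2"
    "cmod (deriv g c) = K * (1 + (cmod (g c) / \<rho>)\<^sup>2)"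
    "\<And>z. dist c z < (r - dist z0 c) / 2 \<Longrightarrow> cmod (deriv g z) \<le> K * (1 + 4 * (cmod (g z) / \<rho>)\<^sup>2)"
proof -
  define \<phi> where "\<phi> z = max 0 (cmod (deriv g z) - K) / (cmod (g z))\<^sup>2" for z
  have \<phi>_nonneg: "0 \<le> \<phi> z" for z
    by (simp add: \<phi>_def)
  have w_dist: "dist z0 w < r / 2"
    using w by simp
  have r: "0 < r"
    using w_dist zero_le_dist[of z0 w] by linarith
  have "continuous_on (cball z0 r) \<phi>"
    unfolding \<phi>_def
    by (rule continuous_on_subset[OF continuous_on_excess_quotient[OF S(1) hol zeros] S(2)])
  then have "continuous_on (cball z0 r) (\<lambda>z. (r - dist z0 z)\<^sup>2 * \<phi> z)"
    by (intro continuous_intros)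
  then obtain c where c: "c \<in> cball z0 r"
    and max: "\<And>z. z \<in> cball z0 r \<Longrightarrow> (r - dist z0 z)\<^sup>2 * \<phi> z \<le> (r - dist z0 c)\<^sup>2 * \<phi> c"
    using continuous_attains_sup[of "cball z0 r" "\<lambda>z. (r - dist z0 z)\<^sup>2 * \<phi> z"] r by auto
  define d where "d = r - dist z0 c"
  have w_in: "w \<in> cball z0 r"
    using w_dist r by simp
  have "K \<le> K + C * (cmod (g w))\<^sup>2"
    using C by simp
  then have dw: "K < cmod (deriv g w)"
    using large by linarith
  have gw: "g w \<noteq> 0"
    using zeros[of w] w_in S(2) dw by force
  have "C < \<phi> w"
    using large dw gw by (simp add: \<phi>_def pos_less_divide_eq)
  have "(r/2)\<^sup>2 * C \<le> (r - dist z0 w)\<^sup>2 * \<phi> w"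
    using w_dist r C \<open>C < \<phi> w\<close> by (intro mult_mono power_mono) auto
  also have "\<dots> \<le> d\<^sup>2 * \<phi> c"
    using max[OF w_in] by (simp add: d_def)
  finally have lower: "(r/2)\<^sup>2 * C \<le> d\<^sup>2 * \<phi> c" .
  have "0 < (r - dist z0 w)\<^sup>2 * \<phi> w"
    using w_dist r C \<open>C < \<phi> w\<close> by (intro mult_pos_pos) auto
  then have "0 < d\<^sup>2 * \<phi> c"
    using max[OF w_in] by (simp add: d_def)
  then have d_ne: "d \<noteq> 0" and \<phi>c: "0 < \<phi> c"
    using \<phi>_nonneg[of c] by (auto simp: zero_less_mult_iff)
  then have d: "0 < d"
    using c by (simp add: d_def)
  define \<rho> where "\<rho> = sqrt (K / \<phi> c)"
  have \<rho>: "0 < \<rho>" and \<rho>2: "\<phi> c = K / \<rho>\<^sup>2"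
    using K \<phi>c by (simp_all add: \<rho>_def)
  have excess: "cmod (deriv g z) \<le> K + \<phi> z * (cmod (g z))\<^sup>2" if "z \<in> S" for z
    using zeros[OF that] by (auto simp: \<phi>_def)
  show ?thesis
  proof
    show "0 < \<rho>"
      by (rule \<rho>)
    show "dist z0 c < r"
      using d by (simp add: d_def)
    show "(r/2)\<^sup>2 * C \<le> K * ((r - dist z0 c) / \<rho>)\<^sup>2"
      using lower unfolding \<rho>2 by (simp add: d_def power_divide mult.commute)
    show "cmod (deriv g c) = K * (1 + (cmod (g c) / \<rho>)\<^sup>2)"
    proof -
      have "cmod (deriv g c) = K + \<phi> c * (cmod (g c))\<^sup>2"
        using \<phi>c by (auto simp: \<phi>_def max_def zero_less_divide_iff split: if_splits)
      then show ?thesis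
        unfolding \<rho>2 by (simp add: power_divide distrib_left)
    qed
    show "cmod (deriv g z) \<le> K * (1 + 4 * (cmod (g z) / \<rho>)\<^sup>2)" if "dist c z < (r - dist z0 c) / 2" for z
    proof -
      have far: "d / 2 \<le> r - dist z0 z"
        using that dist_triangle[of z0 z c] by (simp add: d_def)
      then have z_in: "z \<in> cball z0 r"
        using d by simp
      have "(d/2)\<^sup>2 * \<phi> z \<le> (r - dist z0 z)\<^sup>2 * \<phi> z"
        using far d by (intro mult_right_mono power_mono \<phi>_nonneg) auto
      also have "\<dots> \<le> (d/2)\<^sup>2 * (4 * \<phi> c)"
        using max[OF z_in] by (simp add: d_def power_divide)
      finally have "\<phi> z \<le> 4 * \<phi> c"
        using d by (subst (asm) mult_le_cancel_left_pos) auto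
      then have "\<phi> z * (cmod (g z))\<^sup>2 \<le> 4 * \<phi> c * (cmod (g z))\<^sup>2"
        by (rule mult_right_mono) simp
      then show ?thesis
        using excess[of z] z_in S(2) unfolding \<rho>2 by (auto simp: power_divide algebra_simps)
    qed
  qed
qed

section \<open>Properties preserved by locally uniform limits\<close>

lemma uniform_limit_deriv_half_ball:
  assumes ul: "uniform_limit (ball z s) F h sequentially"
    and F: "\<forall>\<^sub>F n in sequentially. F n holomorphic_on ball z s"
    and h: "h holomorphic_on ball z s" and s: "0 < s"
  shows "uniform_limit (ball z (s/2)) (\<lambda>n. deriv (F n)) (deriv h) sequentially"
proof (rule uniform_limitI)
  fix e :: real assume e: "0 < e"
  have "\<forall>\<^sub>F n in sequentially. \<forall>u\<in>ball z s. dist (F n u) (h u) < e * (s/8)"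
    using e s by (intro uniform_limitD[OF ul]) auto
  then show "\<forall>\<^sub>F n in sequentially. \<forall>w\<in>ball z (s/2). dist (deriv (F n) w) (deriv h w) < e"
    using F
  proof eventually_elim
    case (elim n)
    show ?case
    proof
      fix w assume w: "w \<in> ball z (s/2)"
      have sub: "cball w (s/4) \<subseteq> ball z s"
      proof
        fix u assume "u \<in> cball w (s/4)"
        then show "u \<in> ball z s"
          using w s dist_triangle[of z u w] by simp
      qed
      then have sub': "ball w (s/4) \<subseteq> ball z s"
        using ball_subset_cball by blast
      have diff: "(\<lambda>u. F n u - h u) holomorphic_on ball z s"
        by (intro holomorphic_on_diff elim(2) h)
      have "cmod ((deriv ^^ 1) (\<lambda>u. F n u - h u) w) \<le> fact 1 * (e * (s/8)) / (s/4) ^ 1"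
      proof (rule Cauchy_inequality)
        show "(\<lambda>u. F n u - h u) holomorphic_on ball w (s/4)"
          by (rule holomorphic_on_subset[OF diff sub'])
        show "continuous_on (cball w (s/4)) (\<lambda>u. F n u - h u)"
          by (intro holomorphic_on_imp_continuous_on holomorphic_on_subset[OF diff sub])
        show "cmod (F n u - h u) \<le> e * (s/8)" if "cmod (w - u) = s/4" for u
        proof -
          have "u \<in> ball z s"
            using sub that by (auto simp: dist_norm)
          then show ?thesis
            using elim(1) by (auto simp: dist_norm intro: less_imp_le)
        qed
      qed (use s in auto)
      moreover have "w \<in> ball z s"
        using w s by simp
      then have "deriv (\<lambda>u. F n u - h u) w = deriv (F n) w - deriv h w"
        using elim(2) h by (intro deriv_diff) (auto intro: holomorphic_on_imp_differentiable_at)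
      ultimately show "dist (deriv (F n) w) (deriv h w) < e"
        using e s by (simp add: dist_norm)
    qed
  qed
qed

lemma Hurwitz_no_zeros_eventually:
  assumes S: "open S" "connected S"
    and hol: "\<forall>\<^sub>F n in sequentially. F n holomorphic_on S" "h holomorphic_on S"
    and ul: "uniform_limit S F h sequentially"
    and nz: "\<forall>\<^sub>F n in sequentially. \<forall>z\<in>S. F n z \<noteq> 0"
    and "z0 \<in> S" "h z0 = 0" "z \<in> S"
  shows "h z = 0"
proof -
  obtain N where N: "\<And>n. N \<le> n \<Longrightarrow> F n holomorphic_on S \<and> (\<forall>z\<in>S. F n z \<noteq> 0)"
    using eventually_conj[OF hol(1) nz] by (auto simp: eventually_sequentially)
  have ul': "uniform_limit S (\<lambda>n. F (n + N)) h sequentially"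
    using ul eventually_sequentially_seg[of "\<lambda>n. \<forall>x\<in>S. dist (F n x) (h x) < e" N for e]
    unfolding uniform_limit_iff by simp
  have "h constant_on S"
  proof (rule ccontr)
    assume nc: "\<not> h constant_on S"
    have "h z0 \<noteq> 0"
    proof (rule Hurwitz_no_zeros[of S "\<lambda>n. F (n + N)" h])
      show "uniform_limit K (\<lambda>n. F (n + N)) h sequentially" if "K \<subseteq> S" for K
        using ul' that by (rule uniform_limit_on_subset)
    qed (use N S hol(2) nc \<open>z0 \<in> S\<close> in auto)
    with \<open>h z0 = 0\<close> show False
      by simp
  qed
  then show ?thesis
    using assms(7-9) unfolding constant_on_def by metis
qed

text \<open>
  The spherical derivative of \<open>F n\<close> equals that of its reciprocal, and the reciprocals tend uniformly
  to \<open>0\<close>. Normalised spherical derivatives at a point therefore exclude the limit infinity.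
\<close>

lemma unif_infinite_imp_spherical_derivative_vanishes:
  assumes s: "0 < s" and K: "0 < K"
    and hol: "\<forall>\<^sub>F n in sequentially. F n holomorphic_on ball z0 s"
    and inf: "unif_infinite_on (ball z0 s) F"
  shows "\<forall>\<^sub>F n in sequentially. cmod (deriv (F n) z0) < K * (1 + (cmod (F n z0))\<^sup>2)"
proof -
  define r where "r = s / 2"
  have r: "0 < r"
    using s by (simp add: r_def)
  have sub: "cball z0 r \<subseteq> ball z0 s"
    using s by (auto simp: r_def)
  define m where "m = 1 / (K * r)"
  have m: "0 < m"
    using r K by (simp add: m_def)
  have "\<forall>\<^sub>F n in sequentially. \<forall>z\<in>ball z0 s. m < cmod (F n z)"
    using inf by (simp add: unif_infinite_on_def)
  then show ?thesis
    using hol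
  proof eventually_elim
    case (elim n)
    have big: "m < cmod (F n z)" if "z \<in> ball z0 s" for z
      using elim(1) that by blast
    have nz: "F n z \<noteq> 0" if "z \<in> ball z0 s" for z
      using m big[OF that] by force
    have inv_hol: "(\<lambda>z. inverse (F n z)) holomorphic_on ball z0 s"
      using nz elim(2) by (intro holomorphic_on_inverse) auto
    have "cmod ((deriv ^^ 1) (\<lambda>z. inverse (F n z)) z0) \<le> fact 1 * (1 / m) / r ^ 1"
    proof (rule Cauchy_inequality)
      show "(\<lambda>z. inverse (F n z)) holomorphic_on ball z0 r"
        using sub by (intro holomorphic_on_subset[OF inv_hol]) auto
      show "continuous_on (cball z0 r) (\<lambda>z. inverse (F n z))"
        by (intro holomorphic_on_imp_continuous_on holomorphic_on_subset[OF inv_hol sub])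
      show "cmod (inverse (F n z)) \<le> 1 / m" if "cmod (z0 - z) = r" for z
      proof -
        have "z \<in> ball z0 s"
          using that s by (simp add: dist_norm r_def)
        then have "inverse (cmod (F n z)) \<le> inverse m"
          using big m by (intro le_imp_inverse_le less_imp_le) auto
        then show ?thesis
          by (simp only: norm_inverse inverse_eq_divide norm_divide norm_one)
      qed
    qed (rule r)
    moreover have "1 / m / r = K"
      using r K by (simp add: m_def)
    moreover have "deriv (\<lambda>z. inverse (F n z)) z0 = - deriv (F n) z0 / (F n z0)\<^sup>2"
    proof (rule DERIV_imp_deriv)
      have "(F n has_field_derivative deriv (F n) z0) (at z0)"
        using elim(2) s by (intro holomorphic_derivI) auto
      then show "((\<lambda>z. inverse (F n z)) has_field_derivative - deriv (F n) z0 / (F n z0)\<^sup>2) (at z0)"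
        using nz[of z0] s by (auto intro!: derivative_eq_intros simp: power2_eq_square field_simps)
    qed
    ultimately have "cmod (deriv (F n) z0) / (cmod (F n z0))\<^sup>2 \<le> K"
      by (simp add: norm_divide norm_power)
    then have "cmod (deriv (F n) z0) \<le> K * (cmod (F n z0))\<^sup>2"
      using nz[of z0] s by (simp add: pos_divide_le_eq)
    then show ?case
      using K by (simp add: distrib_left)
  qed
qed

text \<open>
  If \<open>|h' z0| > M\<close> at a zero \<open>z0\<close> of \<open>h\<close>, then \<open>|(F n)'| > M\<close> near \<open>z0\<close>, which leaves \<open>F n\<close> without
  zeros there. By Hurwitz' theorem \<open>h\<close> vanishes identically near \<open>z0\<close>, and so does its derivative.
\<close>

lemma limit_deriv_bound_at_zeros:
  assumes s: "0 < s"
    and F: "\<forall>\<^sub>F n in sequentially. F n holomorphic_on ball z0 s"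
    and h: "h holomorphic_on ball z0 s"
    and ul: "uniform_limit (ball z0 s) F h sequentially"
    and zeros: "\<forall>\<^sub>F n in sequentially. \<forall>z\<in>ball z0 s. F n z = 0 \<longrightarrow> cmod (deriv (F n) z) \<le> M"
    and M: "0 \<le> M" and z0: "h z0 = 0"
  shows "cmod (deriv h z0) \<le> M"
proof (rule ccontr)
  assume contra: "\<not> cmod (deriv h z0) \<le> M"
  define m where "m = (M + cmod (deriv h z0)) / 2"
  have m: "M < m" "m < cmod (deriv h z0)"
    using contra by (auto simp: m_def)
  have "continuous_on (ball z0 s) (deriv h)"
    by (intro holomorphic_on_imp_continuous_on holomorphic_deriv[OF h] open_ball)
  then have "open {z \<in> ball z0 s. m < cmod (deriv h z)}"
    using continuous_open_preimage[OF continuous_on_norm open_ball, of z0 s "deriv h" "{m<..}"]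
    by (simp add: vimage_def Int_def)
  moreover have "z0 \<in> {z \<in> ball z0 s. m < cmod (deriv h z)}"
    using m s by simp
  ultimately obtain s1 where s1: "0 < s1" "ball z0 s1 \<subseteq> {z \<in> ball z0 s. m < cmod (deriv h z)}"
    using open_contains_ball by blast
  define t where "t = min s1 (s/2)"
  have t: "0 < t" "ball z0 t \<subseteq> ball z0 s1" "ball z0 t \<subseteq> ball z0 (s/2)" "ball z0 t \<subseteq> ball z0 s"
    using s1(1) s by (auto simp: t_def)
  have "uniform_limit (ball z0 (s/2)) (\<lambda>n. deriv (F n)) (deriv h) sequentially"
    by (rule uniform_limit_deriv_half_ball[OF ul F h s])
  then have "\<forall>\<^sub>F n in sequentially. \<forall>z\<in>ball z0 (s/2). dist (deriv (F n) z) (deriv h z) < m - M"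
    using m(1) by (intro uniform_limitD) auto
  then have nz: "\<forall>\<^sub>F n in sequentially. \<forall>z\<in>ball z0 t. F n z \<noteq> 0"
    using zeros
  proof eventually_elim
    case (elim n)
    show ?case
    proof (intro ballI notI)
      fix z assume z: "z \<in> ball z0 t" and "F n z = 0"
      then have "cmod (deriv (F n) z) \<le> M"
        using elim(2) t(4) by blast
      moreover have "m < cmod (deriv h z)"
        using s1(2) t(2) z by blast
      moreover have "dist (deriv (F n) z) (deriv h z) < m - M"
        using elim(1) t(3) z by blast
      ultimately show False
        using norm_triangle_sub[of "deriv h z" "deriv (F n) z"]
        by (simp add: dist_norm norm_minus_commute)
    qed
  qed
  have F': "\<forall>\<^sub>F n in sequentially. F n holomorphic_on ball z0 t"
    using F by eventually_elim (rule holomorphic_on_subset[OF _ t(4)])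
  have zero: "h z = 0" if "z \<in> ball z0 t" for z
    by (rule Hurwitz_no_zeros_eventually[OF open_ball connected_ball F'
          holomorphic_on_subset[OF h t(4)] uniform_limit_on_subset[OF ul t(4)] nz _ z0 that])
       (use t(1) in simp)
  have "\<forall>\<^sub>F z in nhds z0. z \<in> ball z0 t"
    using t(1) by (intro eventually_nhds_in_open) auto
  then have "\<forall>\<^sub>F z in nhds z0. h z = 0"
    by eventually_elim (rule zero)
  then have "deriv h z0 = deriv (\<lambda>_. 0) z0"
    by (rule deriv_cong_ev) simp
  then show False
    using m M by simp
qed

text \<open>
  Points at which \<open>(F n)' = b\<close> have \<open>|F n|\<close> tending to infinity, whereas \<open>F n\<close> stays bounded on a
  compact disc. So \<open>(F n)'\<close> eventually omits \<open>b\<close> on it, and Hurwitz' theorem applies to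
  \<open>(F n)' - b\<close>.
\<close>

lemma limit_deriv_equals_if_attained:
  assumes s: "0 < s"
    and F: "\<forall>\<^sub>F n in sequentially. F n holomorphic_on ball z0 s"
    and h: "h holomorphic_on ball z0 s"
    and ul: "uniform_limit (ball z0 s) F h sequentially"
    and E: "filterlim E at_top sequentially"
    and attained: "\<forall>\<^sub>F n in sequentially. \<forall>z\<in>ball z0 s. deriv (F n) z = b \<longrightarrow> E n \<le> cmod (F n z)"
    and z0: "deriv h z0 = b" and z: "z \<in> ball z0 (s/2)"
  shows "deriv h z = b"
proof -
  have sub: "cball z0 (s/2) \<subseteq> ball z0 s" "ball z0 (s/2) \<subseteq> ball z0 s" 
    using s by auto
  have "compact (h ` cball z0 (s/2))"
    by (intro compact_continuous_image holomorphic_on_imp_continuous_on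
        holomorphic_on_subset[OF h sub(1)]) auto
  then have "bounded (h ` cball z0 (s/2))"
    by (rule compact_imp_bounded)
  then obtain Q where Q: "\<forall>u\<in>cball z0 (s/2). cmod (h u) \<le> Q"
    unfolding bounded_iff ball_simps by blast
  have EQ: "\<forall>\<^sub>F n in sequentially. Q + 1 \<le> E n"
    using E by (simp add: filterlim_at_top)
  have "\<forall>\<^sub>F n in sequentially. \<forall>u\<in>ball z0 s. dist (F n u) (h u) < 1"
    by (intro uniform_limitD[OF ul]) auto
  then have nz: "\<forall>\<^sub>F n in sequentially. \<forall>u\<in>ball z0 (s/2). deriv (F n) u - b \<noteq> 0"
    using EQ attained
  proof eventually_elim
    case (elim n)
    show ?case
    proof (intro ballI notI)
      fix u assume u: "u \<in> ball z0 (s/2)" and "deriv (F n) u - b = 0"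
      then have "E n \<le> cmod (F n u)"
        using elim(3) sub(2) by auto
      moreover have "dist (F n u) (h u) < 1"
        using elim(1) sub(2) u by blast
      moreover have "cmod (h u) \<le> Q"
        using Q u by simp
      ultimately show False
        using elim(2) norm_triangle_sub[of "F n u" "h u"] by (simp add: dist_norm)
    qed
  qed
  have "uniform_limit (ball z0 (s/2)) (\<lambda>n. deriv (F n)) (deriv h) sequentially"
    by (rule uniform_limit_deriv_half_ball[OF ul F h s])
  then have ul': "uniform_limit (ball z0 (s/2)) (\<lambda>n u. deriv (F n) u - b) (\<lambda>u. deriv h u - b) sequentially"
    by (simp add: uniform_limit_iff dist_norm)
  have F': "\<forall>\<^sub>F n in sequentially. (\<lambda>u. deriv (F n) u - b) holomorphic_on ball z0 (s/2)"
    using F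
  proof eventually_elim
    case (elim n)
    then show ?case
      by (intro holomorphic_on_diff holomorphic_deriv holomorphic_on_const open_ball
          holomorphic_on_subset[OF _ sub(2)])
  qed
  have h': "(\<lambda>u. deriv h u - b) holomorphic_on ball z0 (s/2)"
    by (intro holomorphic_on_diff holomorphic_deriv holomorphic_on_const open_ball
        holomorphic_on_subset[OF h sub(2)])
  have "deriv h z - b = 0"
    by (rule Hurwitz_no_zeros_eventually[OF open_ball connected_ball F' h' ul' nz, of z0 z])
       (use s z0 z in auto)
  then show ?thesis
    by simp
qed

text \<open>
  A subsequential limit of such a sequence would be an entire function that
  \<open>no_extremal_entire_function\<close> excludes; the limit infinity is excluded by the normalisation at the
  origin. The strict inequality \<open>M < K\<close> keeps the normalised derivative above the bound at zeros.
\<close>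

lemma no_normalised_rescaled_sequence:
  fixes G :: "nat \<Rightarrow> complex \<Rightarrow> complex" and L E :: "nat \<Rightarrow> real"
  assumes L: "filterlim L at_top sequentially" and E: "filterlim E at_top sequentially"
    and hol: "\<And>n. G n holomorphic_on ball 0 (L n)"
    and spherical: "\<And>n z. z \<in> ball 0 (L n) \<Longrightarrow> cmod (deriv (G n) z) \<le> C * (1 + (cmod (G n z))\<^sup>2)"
    and centre: "\<And>n. K * (1 + (cmod (G n 0))\<^sup>2) \<le> cmod (deriv (G n) 0)"
    and zeros: "\<And>n z. z \<in> ball 0 (L n) \<Longrightarrow> G n z = 0 \<Longrightarrow> cmod (deriv (G n) z) \<le> M"
    and value_b: "\<And>n z. z \<in> ball 0 (L n) \<Longrightarrow> deriv (G n) z = b \<Longrightarrow> E n \<le> cmod (G n z)"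
    and M: "0 \<le> M" "M < K" and b: "b \<noteq> 0"
  shows False
proof -
  have L_large: "\<forall>\<^sub>F n in sequentially. ball z s \<subseteq> ball 0 (L n)" for z :: complex and s
  proof -
    have "\<forall>\<^sub>F n in sequentially. cmod z + s \<le> L n"
      using L by (simp add: filterlim_at_top)
    then show ?thesis
    proof eventually_elim
      case (elim n)
      show ?case
      proof
        fix w assume "w \<in> ball z s"
        then show "w \<in> ball 0 (L n)"
          using elim norm_triangle_sub[of w z] by (simp add: dist_norm norm_minus_commute)
      qed
    qed
  qed
  obtain k where k: "strict_mono (k :: nat \<Rightarrow> nat)"
    and lim: "(\<exists>h. h holomorphic_on UNIV \<and> locally_uniform_limit_on UNIV (G \<circ> k) h) \<or>
      locally_unif_infinite_on UNIV (G \<circ> k)"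
  proof (rule Marty_criterion[of UNIV G])
    fix z :: complex
    have "\<forall>\<^sub>F n in sequentially. G n holomorphic_on ball z 1 \<and>
        (\<forall>w\<in>ball z 1. cmod (deriv (G n) w) \<le> C * (1 + (cmod (G n w))\<^sup>2))"
      using L_large[of z 1]
    proof eventually_elim
      case (elim n)
      then show ?case
        using holomorphic_on_subset[OF hol elim] spherical by blast
    qed
    then show "\<exists>s>0. \<exists>C. ball z s \<subseteq> UNIV \<and> (\<forall>\<^sub>F n in sequentially. G n holomorphic_on ball z s \<and>
        (\<forall>w\<in>ball z s. cmod (deriv (G n) w) \<le> C * (1 + (cmod (G n w))\<^sup>2)))"
      by (intro exI[of _ 1] conjI exI[of _ C]) auto
  qed auto
  define F where "F = G \<circ> k"
  have ev_ball: "\<forall>\<^sub>F n in sequentially. ball z s \<subseteq> ball 0 (L (k n))" for z :: complex and s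
    by (rule eventually_subseq[OF k L_large])
  have F_hol: "\<forall>\<^sub>F n in sequentially. F n holomorphic_on ball z s" for z s
    using ev_ball[of z s]
    by eventually_elim (simp add: F_def holomorphic_on_subset[OF hol])
  from lim show False
  proof (elim disjE exE conjE)
    assume "locally_unif_infinite_on UNIV (G \<circ> k)"
    then obtain U where U: "open U" "0 \<in> U" "unif_infinite_on U F"
      unfolding locally_unif_infinite_on_def F_def by auto
    then obtain s where s: "0 < s" "ball 0 s \<subseteq> U"
      using open_contains_ball by blast
    have "unif_infinite_on (ball 0 s) F"
      unfolding unif_infinite_on_def
    proof
      fix m
      have "\<forall>\<^sub>F n in sequentially. \<forall>z\<in>U. m < cmod (F n z)"
        using U(3) by (simp add: unif_infinite_on_def)
      then show "\<forall>\<^sub>F n in sequentially. \<forall>z\<in>ball 0 s. m < cmod (F n z)"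
        by eventually_elim (use s(2) in blast)
    qed
    moreover have "0 < K"
      using M by simp
    ultimately have "\<forall>\<^sub>F n in sequentially. cmod (deriv (F n) 0) < K * (1 + (cmod (F n 0))\<^sup>2)"
      using s(1) F_hol[of 0 s] by (intro unif_infinite_imp_spherical_derivative_vanishes) auto
    then have "\<forall>\<^sub>F n in sequentially. False"
      by eventually_elim (use centre in \<open>simp add: F_def not_less[symmetric]\<close>)
    then show False
      by simp
  next
    fix h assume h: "h holomorphic_on UNIV" and "locally_uniform_limit_on UNIV (G \<circ> k) h"
    then have loc: "\<exists>U. open U \<and> z \<in> U \<and> uniform_limit U F h sequentially" for z
      unfolding locally_uniform_limit_on_def F_def by blast
    have h_on: "h holomorphic_on S" for S
      using h by (rule holomorphic_on_subset) simp
    have ball_limit: "\<exists>s>0. uniform_limit (ball z s) F h sequentially" for z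
    proof -
      obtain U where U: "open U" "z \<in> U" "uniform_limit U F h sequentially"
        using loc by blast
      then obtain s where s: "0 < s" "ball z s \<subseteq> U"
        using open_contains_ball by blast
      have "uniform_limit (ball z s) F h sequentially"
        using U(3) s(2) by (rule uniform_limit_on_subset)
      then show ?thesis
        using s(1) by blast
    qed
    have lims: "(\<lambda>n. F n z) \<longlonglongrightarrow> h z" "(\<lambda>n. deriv (F n) z) \<longlonglongrightarrow> deriv h z" for z
    proof -
      obtain s where s: "0 < s" and ul: "uniform_limit (ball z s) F h sequentially"
        using ball_limit by blast
      show "(\<lambda>n. F n z) \<longlonglongrightarrow> h z"
        using s by (intro tendsto_uniform_limitI[OF ul]) simp
      show "(\<lambda>n. deriv (F n) z) \<longlonglongrightarrow> deriv h z"
        using s by (intro deriv_complex_uniform_limit[OF ul F_hol sequentially_bot]) auto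
    qed
    have in_ball: "\<forall>\<^sub>F n in sequentially. z \<in> ball 0 (L (k n))" for z :: complex
      using ev_ball[of z 1] by eventually_elim (auto dest: subsetD[of _ _ z])
    show False
    proof (rule no_extremal_entire_function[OF h, of C M b])
      show "cmod (deriv h z) \<le> C * (1 + (cmod (h z))\<^sup>2)" for z
      proof (rule tendsto_le[OF sequentially_bot])
        show "(\<lambda>n. C * (1 + (cmod (F n z))\<^sup>2)) \<longlonglongrightarrow> C * (1 + (cmod (h z))\<^sup>2)"
          by (intro tendsto_intros lims)
        show "(\<lambda>n. cmod (deriv (F n) z)) \<longlonglongrightarrow> cmod (deriv h z)"
          by (intro tendsto_intros lims)
        show "\<forall>\<^sub>F n in sequentially. cmod (deriv (F n) z) \<le> C * (1 + (cmod (F n z))\<^sup>2)"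
          using in_ball[of z] by eventually_elim (simp add: F_def spherical)
      qed
      have "K * (1 + (cmod (h 0))\<^sup>2) \<le> cmod (deriv h 0)"
      proof (rule tendsto_le[OF sequentially_bot])
        show "(\<lambda>n. K * (1 + (cmod (F n 0))\<^sup>2)) \<longlonglongrightarrow> K * (1 + (cmod (h 0))\<^sup>2)"
          by (intro tendsto_intros lims)
        show "(\<lambda>n. cmod (deriv (F n) 0)) \<longlonglongrightarrow> cmod (deriv h 0)"
          by (intro tendsto_intros lims)
        show "\<forall>\<^sub>F n in sequentially. K * (1 + (cmod (F n 0))\<^sup>2) \<le> cmod (deriv (F n) 0)"
          by (intro always_eventually allI) (simp add: F_def centre)
      qed
      moreover have "K \<le> K * (1 + (cmod (h 0))\<^sup>2)"
        using M by (simp add: mult_le_cancel_left1)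
      ultimately show "M < cmod (deriv h 0)"
        using M by linarith
      then show "deriv h 0 \<noteq> 0"
        using M by auto
      show "b \<noteq> 0"
        by (rule b)
      show "cmod (deriv h z) \<le> M" if "h z = 0" for z
      proof -
        obtain s where s: "0 < s" and ul: "uniform_limit (ball z s) F h sequentially"
          using ball_limit by blast
        have "\<forall>\<^sub>F n in sequentially. \<forall>u\<in>ball z s. F n u = 0 \<longrightarrow> cmod (deriv (F n) u) \<le> M"
          using ev_ball[of z s] by eventually_elim (use zeros in \<open>auto simp: F_def\<close>)
        then show ?thesis
          by (rule limit_deriv_bound_at_zeros[OF s F_hol h_on ul _ M(1) that])
      qed
      show "(\<forall>z. deriv h z \<noteq> b) \<or> (\<forall>z. deriv h z = b)"
      proof (cases "\<exists>z0. deriv h z0 = b")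
        case True
        then obtain z0 where z0: "deriv h z0 = b"
          by blast
        obtain s where s: "0 < s" and ul: "uniform_limit (ball z0 s) F h sequentially"
          using ball_limit by blast
        have E': "filterlim (E \<circ> k) at_top sequentially"
          unfolding o_def by (rule filterlim_compose[OF E filterlim_subseq[OF k]])
        have "\<forall>\<^sub>F n in sequentially. \<forall>u\<in>ball z0 s. deriv (F n) u = b \<longrightarrow> (E \<circ> k) n \<le> cmod (F n u)"
          using ev_ball[of z0 s] by eventually_elim (use value_b in \<open>auto simp: F_def\<close>)
        then have near: "deriv h z - b = 0" if "z \<in> ball z0 (s/2)" for z
          using limit_deriv_equals_if_attained[OF s F_hol h_on ul E' _ z0 that] by simp
        have "deriv h z - b = 0" for z
        proof (rule analytic_continuation_open[of "ball z0 (s/2)" UNIV "\<lambda>z. deriv h z - b" "\<lambda>_. 0"])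
          show "(\<lambda>z. deriv h z - b) holomorphic_on UNIV"
            by (intro holomorphic_on_diff holomorphic_on_const holomorphic_deriv[OF h]) auto
        qed (use near s in auto)
        then show ?thesis
          by simp
      qed simp
    qed
  qed
qed

section \<open>Locally bounded spherical derivatives\<close>

text \<open>
  Without such a bound, rescaling about suitable centres gives functions on discs with radii tending
  to infinity. Zeros of a rescaled function correspond to zeros of the original one, with the same
  derivative; this is why values and arguments are scaled by the same factor \<open>\<rho>\<close>. A point with derivative \<open>b\<close>
  carries a value of modulus at least \<open>\<epsilon> / \<rho>\<close>, and \<open>\<rho>\<close> tends to \<open>0\<close>.
\<close>

lemma Marty_bound_of_shared_values:
  assumes D: "open D" "z0 \<in> D"
    and hol: "\<And>g. g \<in> \<G> \<Longrightarrow> g holomorphic_on D"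
    and zeros: "\<And>g z. g \<in> \<G> \<Longrightarrow> z \<in> D \<Longrightarrow> g z = 0 \<Longrightarrow> cmod (deriv g z) \<le> M"
    and value_b: "\<And>g z. g \<in> \<G> \<Longrightarrow> z \<in> D \<Longrightarrow> deriv g z = b \<Longrightarrow> \<epsilon> \<le> cmod (g z)"
    and b: "b \<noteq> 0" and \<epsilon>: "0 < \<epsilon>" and M: "0 \<le> M"
  obtains s C where "0 < s" "ball z0 s \<subseteq> D"
    "\<And>g w. g \<in> \<G> \<Longrightarrow> w \<in> ball z0 s \<Longrightarrow> cmod (deriv g w) \<le> C * (1 + (cmod (g w))\<^sup>2)"
proof -
  define K where "K = M + 1"
  have K: "0 < K" "M < K"
    using M by (auto simp: K_def)
  obtain r where r: "0 < r" "cball z0 r \<subseteq> D"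
    using D open_contains_cball by blast
  have "\<exists>C\<ge>0. \<forall>g\<in>\<G>. \<forall>w\<in>ball z0 (r/2). cmod (deriv g w) \<le> K + C * (cmod (g w))\<^sup>2"
  proof (rule ccontr)
    assume "\<not> ?thesis"
    then have unbounded: "\<not> (\<forall>g\<in>\<G>. \<forall>w\<in>ball z0 (r/2). cmod (deriv g w) \<le> K + C * (cmod (g w))\<^sup>2)"
      if "0 \<le> C" for C
      using that by blast
    have "\<exists>g w. g \<in> \<G> \<and> w \<in> ball z0 (r/2) \<and> K + real n * (cmod (g w))\<^sup>2 < cmod (deriv g w)" for n
      using unbounded[of "real n"] by (simp add: not_le Bex_def)
    then obtain g w where g: "\<And>n. g n \<in> \<G>" and w: "\<And>n. w n \<in> ball z0 (r/2)"
      and large: "\<And>n. K + real n * (cmod (g n (w n)))\<^sup>2 < cmod (deriv (g n) (w n))"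
      by metis
    have "\<exists>c \<rho>. 0 < \<rho> \<and> dist z0 c < r \<and> (r/2)\<^sup>2 * real n \<le> K * ((r - dist z0 c) / \<rho>)\<^sup>2 \<and>
        cmod (deriv (g n) c) = K * (1 + (cmod (g n c) / \<rho>)\<^sup>2) \<and>
        (\<forall>z. dist c z < (r - dist z0 c) / 2 \<longrightarrow>
          cmod (deriv (g n) z) \<le> K * (1 + 4 * (cmod (g n z) / \<rho>)\<^sup>2))" for n
    proof -
      have zeros': "cmod (deriv (g n) z) < K" if "z \<in> D" "g n z = 0" for z
        using zeros[OF g that] K(2) by simp
      show ?thesis
        by (rule rescaling_centre[OF D(1) r(2) hol[OF g] K(1) zeros' w _ large]) auto
    qed
    then obtain c \<rho> where \<rho>: "\<And>n. 0 < \<rho> n" and c: "\<And>n. dist z0 (c n) < r"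
      and lower: "\<And>n. (r/2)\<^sup>2 * real n \<le> K * ((r - dist z0 (c n)) / \<rho> n)\<^sup>2"
      and centre: "\<And>n. cmod (deriv (g n) (c n)) = K * (1 + (cmod (g n (c n)) / \<rho> n)\<^sup>2)"
      and upper: "\<And>n z. dist (c n) z < (r - dist z0 (c n)) / 2 \<Longrightarrow>
        cmod (deriv (g n) z) \<le> K * (1 + 4 * (cmod (g n z) / \<rho> n)\<^sup>2)"
      by metis
    \<comment> \<open>In rescaled units, half of the distance from the centre to the boundary of the disc: the estimate around the centre holds up to there.\<close>
    define L where "L n = (r - dist z0 (c n)) / 2 / \<rho> n" for n
    define E where "E n = \<epsilon> / \<rho> n" for n
    define G where "G n \<zeta> = g n (c n + of_real (\<rho> n) * \<zeta>) / of_real (\<rho> n)" for n \<zeta>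
    have L_pos: "0 < L n" for n
      using c[of n] \<rho>[of n] by (simp add: L_def)
    have L: "filterlim L at_top sequentially"
      unfolding filterlim_at_top_gt[where c = 0]
    proof (intro allI impI)
      fix Z :: real assume Z: "0 < Z"
      have "\<forall>\<^sub>F n in sequentially. 16 * K / r\<^sup>2 * Z\<^sup>2 < real n"
        by (rule filterlim_real_sequentially[unfolded filterlim_at_top_dense, rule_format])
      then show "\<forall>\<^sub>F n in sequentially. Z \<le> L n"
      proof eventually_elim
        case (elim n)
        have "16 * K * Z\<^sup>2 < r\<^sup>2 * real n"
          using elim r(1) by (simp add: field_simps)
        also have "\<dots> = 4 * ((r/2)\<^sup>2 * real n)"
          by (simp add: power_divide)
        also have "\<dots> \<le> 4 * (K * (2 * L n)\<^sup>2)"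
        proof -
          have "2 * L n = (r - dist z0 (c n)) / \<rho> n"
            by (simp add: L_def del: right_diff_distrib_numeral)
          then show ?thesis
            using lower[of n] by simp
        qed
        also have "\<dots> = 16 * K * (L n)\<^sup>2"
          by (simp add: power_mult_distrib)
        finally have "Z\<^sup>2 < (L n)\<^sup>2"
          using K(1) by (subst (asm) mult_less_cancel_left_pos) auto
        then have "Z < L n"
          by (rule power2_less_imp_less) (use L_pos[of n] in simp)
        then show "Z \<le> L n"
          by simp
      qed
    qed
    have E: "filterlim E at_top sequentially"
    proof (rule filterlim_at_top_mono)
      show "filterlim (\<lambda>n. (2 * \<epsilon> / r) * L n) at_top sequentially"
        using \<epsilon> r(1) by (intro filterlim_tendsto_pos_mult_at_top[OF tendsto_const _ L]) auto
      show "\<forall>\<^sub>F n in sequentially. (2 * \<epsilon> / r) * L n \<le> E n"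
      proof (intro always_eventually allI)
        fix n
        have "(2 * \<epsilon> / r) * L n = \<epsilon> / \<rho> n * ((r - dist z0 (c n)) / r)"
          by (simp add: L_def)
        also have "\<dots> \<le> \<epsilon> / \<rho> n * 1"
          using \<epsilon> \<rho>[of n] r(1) by (intro mult_left_mono) auto
        finally show "(2 * \<epsilon> / r) * L n \<le> E n"
          by (simp add: E_def)
      qed
    qed
    have close: "dist (c n) (c n + of_real (\<rho> n) * \<zeta>) < (r - dist z0 (c n)) / 2"
      if "\<zeta> \<in> ball 0 (L n)" for n \<zeta>
      using that \<rho>[of n] by (simp add: L_def dist_norm norm_mult pos_less_divide_eq mult.commute)
    have in_D: "c n + of_real (\<rho> n) * \<zeta> \<in> D" if "\<zeta> \<in> ball 0 (L n)" for n \<zeta>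
    proof -
      have "dist z0 (c n + of_real (\<rho> n) * \<zeta>) \<le> r"
      proof -
        define u where "u = c n + of_real (\<rho> n) * \<zeta>"
        have "dist (c n) u < (r - dist z0 (c n)) / 2"
          unfolding u_def by (rule close[OF that])
        then have "dist z0 u \<le> r"
          using dist_triangle[of z0 u "c n"] c[of n] by simp
        then show ?thesis
          by (simp add: u_def)
      qed
      then show ?thesis
        using r(2) by auto
    qed
    have G_deriv: "(G n has_field_derivative deriv (g n) (c n + of_real (\<rho> n) * \<zeta>)) (at \<zeta>)"
      if "\<zeta> \<in> ball 0 (L n)" for n \<zeta>
    proof -
      have "(g n has_field_derivative deriv (g n) (c n + of_real (\<rho> n) * \<zeta>)) (at (c n + of_real (\<rho> n) * \<zeta>))"
        by (rule holomorphic_derivI[OF hol[OF g] D(1) in_D[OF that]])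
      moreover have "((\<lambda>\<zeta>. c n + of_real (\<rho> n) * \<zeta>) has_field_derivative of_real (\<rho> n)) (at \<zeta>)"
        by (auto intro!: derivative_eq_intros)
      ultimately have "((\<lambda>\<zeta>. g n (c n + of_real (\<rho> n) * \<zeta>)) has_field_derivative
          deriv (g n) (c n + of_real (\<rho> n) * \<zeta>) * of_real (\<rho> n)) (at \<zeta>)"
        by (rule DERIV_chain2)
      from DERIV_cdivide[OF this, of "of_real (\<rho> n)"] show ?thesis
        using \<rho>[of n] by (simp add: G_def[abs_def])
    qed
    note G_deriv' = DERIV_imp_deriv[OF G_deriv]
    have norm_G: "cmod (G n \<zeta>) = cmod (g n (c n + of_real (\<rho> n) * \<zeta>)) / \<rho> n" for n \<zeta>
      using \<rho>[of n] by (simp add: G_def norm_divide)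
    show False
    proof (rule no_normalised_rescaled_sequence[of L E G "4 * K" K M b])
      show "G n holomorphic_on ball 0 (L n)" for n
        unfolding holomorphic_on_open[OF open_ball] by (intro ballI exI) (rule G_deriv)
      show "cmod (deriv (G n) \<zeta>) \<le> 4 * K * (1 + (cmod (G n \<zeta>))\<^sup>2)" if "\<zeta> \<in> ball 0 (L n)" for n \<zeta>
      proof -
        have "cmod (deriv (G n) \<zeta>) \<le> K * (1 + 4 * (cmod (G n \<zeta>))\<^sup>2)"
          unfolding G_deriv'[OF that] norm_G by (rule upper[OF close[OF that]])
        also have "\<dots> \<le> 4 * K * (1 + (cmod (G n \<zeta>))\<^sup>2)"
          using K(1) by (simp add: algebra_simps)
        finally show ?thesis .
      qed
      show "K * (1 + (cmod (G n 0))\<^sup>2) \<le> cmod (deriv (G n) 0)" for n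
        using centre[of n] G_deriv'[of 0 n] L_pos[of n] norm_G[of n 0] by simp
      show "cmod (deriv (G n) \<zeta>) \<le> M" if "\<zeta> \<in> ball 0 (L n)" "G n \<zeta> = 0" for n \<zeta>
        using zeros[OF g in_D[OF that(1)]] that(2) \<rho>[of n] unfolding G_deriv'[OF that(1)]
        by (simp add: G_def)
      show "E n \<le> cmod (G n \<zeta>)" if "\<zeta> \<in> ball 0 (L n)" "deriv (G n) \<zeta> = b" for n \<zeta>
      proof -
        have "\<epsilon> \<le> cmod (g n (c n + of_real (\<rho> n) * \<zeta>))"
          using that by (intro value_b[OF g in_D]) (auto simp: G_deriv')
        then show ?thesis
          using \<rho>[of n] unfolding norm_G E_def by (simp add: divide_right_mono)
      qed
    qed (use L E M K b in auto)
  qed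
  then obtain C where C: "0 \<le> C"
    "\<And>g w. g \<in> \<G> \<Longrightarrow> w \<in> ball z0 (r/2) \<Longrightarrow> cmod (deriv g w) \<le> K + C * (cmod (g w))\<^sup>2"
    by blast
  show ?thesis
  proof
    show "0 < r / 2"
      using r(1) by simp
    show "ball z0 (r/2) \<subseteq> D"
      using r by auto
    fix g w assume "g \<in> \<G>" "w \<in> ball z0 (r/2)"
    then have "cmod (deriv g w) \<le> K + C * (cmod (g w))\<^sup>2"
      by (rule C(2))
    also have "\<dots> \<le> (K + C) * (1 + (cmod (g w))\<^sup>2)"
      using C(1) K(1) by (simp add: algebra_simps)
    finally show "cmod (deriv g w) \<le> (K + C) * (1 + (cmod (g w))\<^sup>2)" .
  qed
qed

section \<open>Convergence in the spherical metric\<close>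

lemma chordal_dist_nonneg: "0 \<le> chordal_dist p q"
  by (cases p; cases q) auto

lemma spherical_dist_less_if_chordal_dist_less:
  assumes "0 < e"
  obtains \<delta> where "0 < \<delta>" "\<And>p q. chordal_dist p q < \<delta> \<Longrightarrow> spherical_dist p q < e"
proof
  define t where "t = min (e/4) 1"
  have t: "0 < t" "t \<le> 1" "t \<le> e/4"
    using assms by (auto simp: t_def)
  have pi: "t \<le> pi/2" "t < pi"
    using t pi_gt3 by auto
  show "0 < 2 * sin t"
    using sin_gt_zero[OF t(1) pi(2)] by simp
  show "spherical_dist p q < e" if "chordal_dist p q < 2 * sin t" for p q
  proof -
    have "arcsin (chordal_dist p q / 2) \<le> arcsin (sin t)"
      using that chordal_dist_nonneg[of p q] by (intro arcsin_le_arcsin) auto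
    also have "\<dots> = t"
      using t pi by (intro arcsin_sin) auto
    finally show ?thesis
      using t assms by (simp add: spherical_dist_def)
  qed
qed

lemma chordal_dist_finite_le: "chordal_dist (Finite z) (Finite w) \<le> 2 * dist z w"
proof -
  have "1 \<le> sqrt (1 + (cmod z)\<^sup>2) * sqrt (1 + (cmod w)\<^sup>2)"
    using mult_mono[of 1 "sqrt (1 + (cmod z)\<^sup>2)" 1 "sqrt (1 + (cmod w)\<^sup>2)"] by simp
  then have "2 * dist z w / (sqrt (1 + (cmod z)\<^sup>2) * sqrt (1 + (cmod w)\<^sup>2)) \<le> 2 * dist z w / 1"
    by (intro divide_left_mono) auto
  then show ?thesis
    by (simp add: dist_norm)
qed

lemma chordal_dist_infinity_less:
  assumes "0 < \<delta>" "2 / \<delta> < cmod z"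
  shows "chordal_dist (Finite z) Infinity < \<delta>"
proof -
  have "2 / \<delta> < sqrt (1 + (cmod z)\<^sup>2)"
    using assms(2) by (rule less_le_trans) (rule real_le_rsqrt, simp)
  moreover have "0 < sqrt (1 + (cmod z)\<^sup>2)"
    by (simp add: add_pos_nonneg)
  ultimately show ?thesis
    using assms(1) by (simp add: field_simps)
qed

lemma spherically_converges_if_locally_uniform_limit:
  assumes D: "open D" and F: "\<And>n. F n holomorphic_on D" and h: "h holomorphic_on D"
    and lim: "locally_uniform_limit_on D F h"
  shows "spherically_converges_locally_uniformly_on (\<lambda>n. sphere_val (F n)) (sphere_val h) D"
  unfolding spherically_converges_locally_uniformly_on_def
proof
  fix z assume "z \<in> D"
  then obtain U where U: "open U" "z \<in> U" "U \<subseteq> D" and ul: "uniform_limit U F h sequentially"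
    using lim unfolding locally_uniform_limit_on_def by blast
  have "\<forall>\<^sub>F n in sequentially. \<forall>w\<in>U. spherical_dist (sphere_val (F n) w) (sphere_val h w) < e"
    if "0 < e" for e
  proof -
    obtain \<delta> where \<delta>: "0 < \<delta>" "\<And>p q. chordal_dist p q < \<delta> \<Longrightarrow> spherical_dist p q < e"
      using spherical_dist_less_if_chordal_dist_less[OF \<open>0 < e\<close>] by blast
    have "\<forall>\<^sub>F n in sequentially. \<forall>w\<in>U. dist (F n w) (h w) < \<delta> / 2"
      using \<delta>(1) by (intro uniform_limitD[OF ul]) simp
    then show ?thesis
    proof eventually_elim
      case (elim n)
      show ?case
      proof
        fix w assume w: "w \<in> U"
        have "chordal_dist (Finite (F n w)) (Finite (h w)) \<le> 2 * dist (F n w) (h w)"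
          by (rule chordal_dist_finite_le)
        also have "\<dots> < \<delta>"
          using elim w by force
        finally show "spherical_dist (sphere_val (F n) w) (sphere_val h w) < e"
          using \<delta>(2) w U(3) sphere_val_holomorphic[OF D F] sphere_val_holomorphic[OF D h] by auto
      qed
    qed
  qed
  then show "\<exists>U. open U \<and> z \<in> U \<and> U \<subseteq> D \<and> (\<forall>e>0. \<forall>\<^sub>F n in sequentially. \<forall>w\<in>U.
      spherical_dist (sphere_val (F n) w) (sphere_val h w) < e)"
    using U by (intro exI[of _ U]) simp
qed

lemma spherically_converges_if_locally_unif_infinite:
  assumes D: "open D" and F: "\<And>n. F n holomorphic_on D"
    and lim: "locally_unif_infinite_on D F"
  shows "spherically_converges_locally_uniformly_on (\<lambda>n. sphere_val (F n)) (\<lambda>_. Infinity) D"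
  unfolding spherically_converges_locally_uniformly_on_def
proof
  fix z assume "z \<in> D"
  then obtain U where U: "open U" "z \<in> U" "U \<subseteq> D" and inf: "unif_infinite_on U F"
    using lim unfolding locally_unif_infinite_on_def by blast
  have "\<forall>\<^sub>F n in sequentially. \<forall>w\<in>U. spherical_dist (sphere_val (F n) w) Infinity < e"
    if "0 < e" for e
  proof -
    obtain \<delta> where \<delta>: "0 < \<delta>" "\<And>p q. chordal_dist p q < \<delta> \<Longrightarrow> spherical_dist p q < e"
      using spherical_dist_less_if_chordal_dist_less[OF \<open>0 < e\<close>] by blast
    have "\<forall>\<^sub>F n in sequentially. \<forall>w\<in>U. 2 / \<delta> < cmod (F n w)"
      using inf by (simp add: unif_infinite_on_def)
    then show ?thesis
    proof eventually_elim
      case (elim n)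
      show ?case
      proof
        fix w assume w: "w \<in> U"
        have "chordal_dist (Finite (F n w)) Infinity < \<delta>"
          using elim w \<delta>(1) by (intro chordal_dist_infinity_less) auto
        then show "spherical_dist (sphere_val (F n) w) Infinity < e"
          using \<delta>(2) w U(3) sphere_val_holomorphic[OF D F] by auto
      qed
    qed
  qed
  then show "\<exists>U. open U \<and> z \<in> U \<and> U \<subseteq> D \<and> (\<forall>e>0. \<forall>\<^sub>F n in sequentially. \<forall>w\<in>U.
      spherical_dist (sphere_val (F n) w) Infinity < e)"
    using U by (intro exI[of _ U]) simp
qed

lemma locally_uniform_limit_on_add_const:
  assumes "locally_uniform_limit_on D F h"
  shows "locally_uniform_limit_on D (\<lambda>n z. F n z + a) (\<lambda>z. h z + a)"
  using assms by (simp add: locally_uniform_limit_on_def uniform_limit_iff)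

lemma locally_unif_infinite_on_add_const:
  assumes "locally_unif_infinite_on D F"
  shows "locally_unif_infinite_on D (\<lambda>n z. F n z + a)"
proof -
  have "unif_infinite_on U (\<lambda>n z. F n z + a)" if "unif_infinite_on U F" for U
    unfolding unif_infinite_on_def
  proof
    fix m
    have "\<forall>\<^sub>F n in sequentially. \<forall>z\<in>U. m + cmod a < cmod (F n z)"
      using that by (simp add: unif_infinite_on_def)
    then show "\<forall>\<^sub>F n in sequentially. \<forall>z\<in>U. m < cmod (F n z + a)"
    proof eventually_elim
      case (elim n)
      show ?case
      proof
        fix z assume "z \<in> U"
        then have "m + cmod a < cmod (F n z)"
          using elim by blast
        then show "m < cmod (F n z + a)"
          using norm_diff_ineq[of "F n z" a] by linarith
      qed
    qed
  qed
  then show ?thesis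
    using assms unfolding locally_unif_infinite_on_def by blast
qed

section \<open>Normality\<close>

theorem theorem2p9:
  fixes D A B :: "complex set" and \<F> :: "(complex \<Rightarrow> complex) set"
    and a b :: complex and \<epsilon> :: real
  assumes "open D" and "connected D" and "D \<noteq> {}"
    and "\<And>f. f \<in> \<F> \<Longrightarrow> f holomorphic_on D"
    and "a \<noteq> b" and "b \<noteq> 0"
    and "compact A" and "b \<notin> A"
    and "\<epsilon> > 0" and "B = {z. cmod (z - a) \<ge> \<epsilon>}"
    and "\<And>f. f \<in> \<F> \<Longrightarrow> partially_share D f (deriv f) a A"
    and "\<And>f. f \<in> \<F> \<Longrightarrow> partially_share D (deriv f) f b B"
  shows "normal_family_on \<F> D"
proof -
  note D = assms(1) and hol = assms(4)
  have hol': "deriv f holomorphic_on D" if "f \<in> \<F>" for f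
    by (rule holomorphic_deriv[OF hol[OF that] D])
  obtain M where M: "0 \<le> M" "\<And>u. u \<in> A \<Longrightarrow> cmod u \<le> M"
    using compact_imp_bounded[OF assms(7)] bounded_pos by (metis less_imp_le)
  \<comment> \<open>Subtracting \<open>a\<close> turns the shared value into zero and the set \<open>B\<close> into the complement of a disc about \<open>0\<close>.\<close>
  define \<G> where "\<G> = (\<lambda>f z. f z - a) ` \<F>"
  have deriv_G: "deriv (\<lambda>z. f z - a) z = deriv f z" if "f \<in> \<F>" "z \<in> D" for f z
    using holomorphic_derivI[OF hol[OF that(1)] D that(2)]
    by (intro DERIV_imp_deriv) (auto intro!: derivative_eq_intros)
  have G_hol: "g holomorphic_on D" if "g \<in> \<G>" for g
    using that hol by (auto simp: \<G>_def intro!: holomorphic_intros)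
  have G_zeros: "cmod (deriv g z) \<le> M" if "g \<in> \<G>" "z \<in> D" "g z = 0" for g z
    using that assms(11) M(2) partially_share_holomorphic_iff[OF D hol hol']
    by (auto simp: \<G>_def deriv_G)
  have G_values: "\<epsilon> \<le> cmod (g z)" if "g \<in> \<G>" "z \<in> D" "deriv g z = b" for g z
    using that assms(12) partially_share_holomorphic_iff[OF D hol' hol]
    by (auto simp: \<G>_def deriv_G assms(10))
  show ?thesis
    unfolding normal_family_on_def
  proof (intro allI impI)
    fix f :: "nat \<Rightarrow> complex \<Rightarrow> complex"
    assume f: "\<forall>n. f n \<in> \<F>"
    define F where "F n z = f n z - a" for n z
    have F: "F n \<in> \<G>" for n
      unfolding \<G>_def F_def[abs_def] using f by (intro image_eqI[of _ _ "f n"]) auto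
    obtain k where k: "strict_mono (k :: nat \<Rightarrow> nat)"
      and lim: "(\<exists>h. h holomorphic_on D \<and> locally_uniform_limit_on D (F \<circ> k) h) \<or>
        locally_unif_infinite_on D (F \<circ> k)"
    proof (rule Marty_criterion[OF assms(1-3), of F])
      fix z assume "z \<in> D"
      then obtain s C where s: "0 < s" "ball z s \<subseteq> D"
        "\<And>g w. g \<in> \<G> \<Longrightarrow> w \<in> ball z s \<Longrightarrow> cmod (deriv g w) \<le> C * (1 + (cmod (g w))\<^sup>2)"
        using Marty_bound_of_shared_values[of D z \<G> M b \<epsilon>] D G_hol G_zeros G_values assms(6,9) M(1)
        by blast
      have "F n holomorphic_on ball z s" for n
        using holomorphic_on_subset[OF G_hol[OF F] s(2)] .
      then show "\<exists>s>0. \<exists>C. ball z s \<subseteq> D \<and> (\<forall>\<^sub>F n in sequentially. F n holomorphic_on ball z s \<and>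
          (\<forall>w\<in>ball z s. cmod (deriv (F n) w) \<le> C * (1 + (cmod (F n w))\<^sup>2)))"
        using s F by (intro exI[of _ s] conjI exI[of _ C] always_eventually) auto
    qed
    have fk: "(\<lambda>n. f (k n)) = (\<lambda>n z. (F \<circ> k) n z + a)"
      by (simp add: F_def)
    have fk_hol: "f (k n) holomorphic_on D" for n
      using f hol by blast
    from lim show "\<exists>r g. strict_mono (r :: nat \<Rightarrow> nat) \<and>
        ((\<exists>h. h nicely_meromorphic_on D \<and> (\<forall>z\<in>D. g z = sphere_val h z)) \<or> (\<forall>z\<in>D. g z = Infinity)) \<and>
        spherically_converges_locally_uniformly_on (\<lambda>n. sphere_val (f (r n))) g D"
    proof (elim disjE exE conjE)
      fix h assume h: "h holomorphic_on D" and "locally_uniform_limit_on D (F \<circ> k) h"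
      then have "locally_uniform_limit_on D (\<lambda>n. f (k n)) (\<lambda>z. h z + a)"
        unfolding fk by (intro locally_uniform_limit_on_add_const)
      moreover have ha: "(\<lambda>z. h z + a) holomorphic_on D"
        using h by (intro holomorphic_intros)
      ultimately have "spherically_converges_locally_uniformly_on (\<lambda>n. sphere_val (f (k n)))
          (sphere_val (\<lambda>z. h z + a)) D"
        by (intro spherically_converges_if_locally_uniform_limit D fk_hol)
      moreover have "(\<lambda>z. h z + a) nicely_meromorphic_on D"
        using ha D by (intro analytic_on_imp_nicely_meromorphic_on) (simp add: analytic_on_open)
      ultimately show ?thesis
        using k by (intro exI[of _ k] exI[of _ "sphere_val (\<lambda>z. h z + a)"]) auto
    next
      assume "locally_unif_infinite_on D (F \<circ> k)"
      then have "locally_unif_infinite_on D (\<lambda>n. f (k n))"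
        unfolding fk by (rule locally_unif_infinite_on_add_const)
      then have "spherically_converges_locally_uniformly_on (\<lambda>n. sphere_val (f (k n))) (\<lambda>_. Infinity) D"
        by (intro spherically_converges_if_locally_unif_infinite D fk_hol)
      then show ?thesis
        using k by (intro exI[of _ k] exI[of _ "\<lambda>_. Infinity"]) auto
    qed
  qed
qed

end
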